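(* Let $C$ be an analytic reduced plane curve defined by $f=\prod_{i\in I}f_i\in\mathbb{C}\{X,Y\}$ with $I=\{1,\ldots,r\}$, $r>1$, where the $f_i$ are irreducible and $\langle f_i\rangle\neq\langle f_l\rangle$ for $i\neq l$. Let $1\leq j<r$, $J=\{1,\ldots,j\}$, $K=\{j+1,\ldots,r\}$, and let $C_J$ and $C_K$ denote the plane curves defined by $\prod_{i\in J}f_i$ and $\prod_{k\in K}f_k$, respectively. Then $$\tau(C)=\tau(C_J)+\tau(C_K)+\mathrm{I}(C_J,C_K)+\sum_{k\in K}\sharp\left(\nu_k\left(\mathcal{N}_{[j+1,k)}\right)\setminus\nu_k\left(\mathcal{N}_{[1,k)}\right)\right),$$ where $\mathrm{I}(C_J,C_K)=\sum_{i\in J,\,k\in K}\mathrm{I}(f_i,f_k)$, $\mathcal{N}:=\mathcal{N}(\mathcal{J}(f))$ and $\nu_{j+1}\left(\mathcal{N}_{[j+1,j+1)}\right):=\Delta_{j+1}$.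
   Context: $\mathcal{O}=\mathbb{C}\{X,Y\}/\langle f\rangle$ and $\mathcal{O}_i=\mathbb{C}\{X,Y\}/\langle f_i\rangle$. The normalization of $\mathcal{O}_i$ is identified with a one-variable power series ring in $t_i$, with fraction field $\mathcal{K}_i$, and $\mathcal{O}\subset\prod_{i\in I}\mathcal{O}_i\subset\mathcal{K}=\prod_{i\in I}\mathcal{K}_i$, the total ring of fractions of $\mathcal{O}$; $\pi_i:\mathcal{K}\to\mathcal{K}_i$ is the projection. $\nu_i$ is the $t_i$-adic order on $\mathcal{K}_i$ (with $\nu_i(0)=\infty$), and $\nu_i(z):=\nu_i(\pi_i(z))$ for $z\in\mathcal{K}$. The Jacobian ideal of $f$ is $\mathcal{J}(f)=\{Af_X+Bf_Y;\ A,B\in\mathcal{O}\}\subseteq\mathcal{O}$, and $\Delta_i=\nu_i(\pi_i(\mathcal{J}(f)))$. For $L\subseteq I$, $\mathcal{N}_L=\mathcal{N}_L(\mathcal{J}(f))=\{z\in\mathcal{J}(f):\ \pi_l(z)=0\ \text{for all } l\in L\}$; for $a<b$, $[a,b)=\{a,a+1,\ldots,b-1\}$. For a reduced plane curve germ $D$ defined by $g$, $\tau(D)=\dim_{\mathbb{C}}\mathbb{C}\{X,Y\}/\langle g,g_X,g_Y\rangle$. $\mathrm{I}(g,h)=\dim_{\mathbb{C}}\mathbb{C}\{X,Y\}/\langle g,h\rangle$. $\sharp$ denotes cardinality. *)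

theory Defs
  imports "HOL-Analysis.FPS_Convergence" "HOL-Analysis.Infinite_Sum" "HOL-Library.Extended"
    "HOL-Library.Extended_Nat" "HOL-Computational_Algebra.Computational_Algebra"
begin

unbundle no vec_syntax
unbundle fps_syntax

text \<open>
  A formal power series \<open>F = \<Sum> a\<^sub>m\<^sub>n X\<^sup>m Y\<^sup>n\<close> is an element of \<open>complex fps fps\<close>: the outer variable
  is \<open>X\<close>, the inner one is \<open>Y\<close>, and \<open>a\<^sub>m\<^sub>n = F $ m $ n\<close>.  It is convergent if it converges
  absolutely on some polydisc around the origin.
\<close>

definition convergent2 :: "complex fps fps \<Rightarrow> bool" where
  "convergent2 F \<longleftrightarrow>
     (\<exists>\<rho>>0::real. (\<lambda>(m, n). norm (F $ m $ n) * \<rho> ^ m * \<rho> ^ n) summable_on UNIV)"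

lemma convergent2_iff_bound:
  "convergent2 F \<longleftrightarrow> (\<exists>M R. R > 0 \<and> (\<forall>m n. norm (F $ m $ n) \<le> M * R ^ (m + n)))"
proof
  assume "convergent2 F"
  then obtain \<rho> :: real where \<rho>: "\<rho> > 0"
    and s: "(\<lambda>(m, n). norm (F $ m $ n) * \<rho> ^ m * \<rho> ^ n) summable_on UNIV"
    (is "?g summable_on UNIV")
    unfolding convergent2_def by auto
  have "norm (F $ m $ n) \<le> infsum ?g UNIV * (1 / \<rho>) ^ (m + n)" for m n
  proof -
    have "sum ?g {(m, n)} \<le> infsum ?g UNIV"
      using \<rho> by (intro finite_sum_le_infsum[OF s]) auto
    then have "norm (F $ m $ n) * \<rho> ^ (m + n) \<le> infsum ?g UNIV"
      by (simp add: power_add mult.assoc)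
    then show ?thesis using \<rho> by (simp add: field_simps power_one_over)
  qed
  then show "\<exists>M R. R > 0 \<and> (\<forall>m n. norm (F $ m $ n) \<le> M * R ^ (m + n))"
    using \<rho> by (intro exI[of _ "infsum ?g UNIV"] exI[of _ "1 / \<rho>"]) auto
next
  assume "\<exists>M R. R > 0 \<and> (\<forall>m n. norm (F $ m $ n) \<le> M * R ^ (m + n))"
  then obtain M R where R: "R > 0" and b: "\<And>m n. norm (F $ m $ n) \<le> M * R ^ (m + n)" by blast
  define \<rho> where "\<rho> = 1 / (2 * R)"
  have \<rho>: "\<rho> > 0" using R by (simp add: \<rho>_def)
  define g :: "nat \<times> nat \<Rightarrow> real" where "g = (\<lambda>(m, n). norm (F $ m $ n) * \<rho> ^ m * \<rho> ^ n)"
  have M: "M \<ge> 0" using order.trans[OF norm_ge_zero b[of 0 0]] by simp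
  have g: "0 \<le> g p" "g p \<le> M * (1/2) ^ fst p * (1/2) ^ snd p" for p
  proof -
    obtain m n where p: "p = (m, n)" by (cases p)
    show "0 \<le> g p" using \<rho> by (simp add: g_def p)
    have "g p = norm (F $ m $ n) * \<rho> ^ (m + n)" by (simp add: g_def p power_add)
    also have "\<dots> \<le> (M * R ^ (m + n)) * \<rho> ^ (m + n)"
      using \<rho> by (intro mult_right_mono b) auto
    also have "\<dots> = M * (R * \<rho>) ^ (m + n)" by (simp add: power_mult_distrib)
    also have "R * \<rho> = 1 / 2" using R by (simp add: \<rho>_def)
    finally show "g p \<le> M * (1/2) ^ fst p * (1/2) ^ snd p" by (simp add: p power_add)
  qed
  have half: "(\<Sum>n\<in>{..<k}. (1/2) ^ n :: real) \<le> 2" for k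
    by (simp add: sum_gp_strict)
  have "g summable_on UNIV"
  proof (rule nonneg_bdd_above_summable_on)
    show "bdd_above (sum g ` {P. P \<subseteq> UNIV \<and> finite P})"
    proof (rule bdd_aboveI2)
      fix P :: "(nat \<times> nat) set" assume "P \<in> {P. P \<subseteq> UNIV \<and> finite P}"
      then have P: "finite P" by simp
      then obtain k where k: "fst ` P \<union> snd ` P \<subseteq> {..<k}"
        by (metis finite_UnI finite_imageI finite_nat_iff_bounded)
      then have sub: "P \<subseteq> {..<k} \<times> {..<k}" by force
      have "sum g P \<le> (\<Sum>p\<in>{..<k} \<times> {..<k}. g p)"
        by (rule sum_mono2) (use sub g(1) in auto)
      also have "\<dots> \<le> (\<Sum>p\<in>{..<k} \<times> {..<k}. M * (1/2) ^ fst p * (1/2) ^ snd p)"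
        by (rule sum_mono) (rule g(2))
      also have "\<dots> = M * (\<Sum>m<k. (1/2) ^ m) * (\<Sum>n<k. (1/2) ^ n)"
        by (simp only: sum.cartesian_product' fst_conv snd_conv sum_distrib_left sum_distrib_right)
           (rule sum.swap)
      also have "\<dots> \<le> M * 2 * 2"
        using M by (intro mult_mono half) (auto intro: sum_nonneg)
      finally show "sum g P \<le> M * 2 * 2" .
    qed
  qed (rule g(1))
  then show "convergent2 F" unfolding convergent2_def g_def using \<rho> by blast
qed

lemma convergent2_obtain:
  assumes "convergent2 F"
  obtains M R where "M \<ge> 0" "R \<ge> 1" "\<And>R' m n. R' \<ge> R \<Longrightarrow> norm (F $ m $ n) \<le> M * R' ^ (m + n)"
proof -
  from assms obtain M R where R: "R > 0" and b: "\<And>m n. norm (F $ m $ n) \<le> M * R ^ (m + n)"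
    unfolding convergent2_iff_bound by blast
  have M: "M \<ge> 0" using order.trans[OF norm_ge_zero b[of 0 0]] by simp
  show thesis
  proof
    show "M \<ge> 0" by (rule M)
    show "max 1 R \<ge> 1" by simp
    fix R' m n assume "max 1 R \<le> R'"
    then have "M * R ^ (m + n) \<le> M * R' ^ (m + n)"
      using R M by (intro mult_left_mono power_mono) auto
    with b[of m n] show "norm (F $ m $ n) \<le> M * R' ^ (m + n)" by simp
  qed
qed

lemma convergent2_const: "convergent2 (fps_const (fps_const c))"
  unfolding convergent2_iff_bound
  by (intro exI[of _ "norm c"] exI[of _ 1]) auto

lemma convergent2_zero: "convergent2 0"
  using convergent2_const[of 0] by simp

lemma convergent2_one: "convergent2 1"
  using convergent2_const[of 1] by simp

lemma convergent2_uminus: "convergent2 F \<Longrightarrow> convergent2 (- F)"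
  unfolding convergent2_iff_bound by simp

lemma convergent2_add:
  assumes "convergent2 F" "convergent2 G"
  shows "convergent2 (F + G)"
proof -
  obtain M R where F: "R \<ge> 1" "\<And>R' m n. R' \<ge> R \<Longrightarrow> norm (F $ m $ n) \<le> M * R' ^ (m + n)"
    using convergent2_obtain[OF assms(1)] by metis
  obtain N S where G: "S \<ge> 1" "\<And>R' m n. R' \<ge> S \<Longrightarrow> norm (G $ m $ n) \<le> N * R' ^ (m + n)"
    using convergent2_obtain[OF assms(2)] by metis
  have "norm ((F + G) $ m $ n) \<le> (M + N) * max R S ^ (m + n)" for m n
    using norm_triangle_mono[OF F(2)[of "max R S" m n] G(2)[of "max R S" m n]]
    by (simp add: distrib_right)
  then show ?thesis unfolding convergent2_iff_bound using F(1)
    by (intro exI[of _ "M + N"] exI[of _ "max R S"]) auto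
qed

lemma convergent2_diff: "convergent2 F \<Longrightarrow> convergent2 G \<Longrightarrow> convergent2 (F - G)"
  using convergent2_add[of F "- G"] convergent2_uminus[of G] by simp

lemma Suc_le_two_power: "real (Suc n) \<le> 2 ^ n"
proof -
  have "Suc n \<le> 2 ^ n" by (simp add: Suc_leI)
  then show ?thesis by (metis of_nat_le_iff of_nat_numeral of_nat_power)
qed

lemma convergent2_mult:
  assumes "convergent2 F" "convergent2 G"
  shows "convergent2 (F * G)"
proof -
  obtain M R where F: "M \<ge> 0" "R \<ge> 1" "\<And>R' m n. R' \<ge> R \<Longrightarrow> norm (F $ m $ n) \<le> M * R' ^ (m + n)"
    using convergent2_obtain[OF assms(1)] by metis
  obtain N S where G: "N \<ge> 0" "S \<ge> 1" "\<And>R' m n. R' \<ge> S \<Longrightarrow> norm (G $ m $ n) \<le> N * R' ^ (m + n)"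
    using convergent2_obtain[OF assms(2)] by metis
  define Q where "Q = max R S"
  have Q: "Q \<ge> 1" "Q \<ge> R" "Q \<ge> S" using F(2) by (auto simp: Q_def)
  have "norm ((F * G) $ m $ n) \<le> (M * N) * (2 * Q) ^ (m + n)" for m n
  proof -
    have "(F * G) $ m $ n = (\<Sum>i=0..m. \<Sum>k=0..n. F $ i $ k * G $ (m - i) $ (n - k))"
      by (simp add: fps_mult_nth fps_sum_nth)
    also have "norm \<dots> \<le> (\<Sum>i=0..m. \<Sum>k=0..n. norm (F $ i $ k * G $ (m - i) $ (n - k)))"
      by (intro order.trans[OF norm_sum] sum_mono order.refl)
    also have "\<dots> \<le> (\<Sum>i=0..m. \<Sum>k=0..n. (M * N) * Q ^ (m + n))"
    proof (intro sum_mono)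
      fix i k assume ik: "i \<in> {0..m}" "k \<in> {0..n}"
      have "norm (F $ i $ k * G $ (m - i) $ (n - k))
          \<le> (M * Q ^ (i + k)) * (N * Q ^ ((m - i) + (n - k)))"
        unfolding norm_mult using F(1,3) G(1,3) Q by (intro mult_mono) auto
      also have "\<dots> = (M * N) * Q ^ ((i + k) + ((m - i) + (n - k)))"
        by (simp add: power_add)
      also have "(i + k) + ((m - i) + (n - k)) = m + n" using ik by auto
      finally show "norm (F $ i $ k * G $ (m - i) $ (n - k)) \<le> (M * N) * Q ^ (m + n)" .
    qed
    also have "\<dots> = (real (Suc m) * real (Suc n)) * ((M * N) * Q ^ (m + n))" by simp
    also have "\<dots> \<le> (2 ^ m * 2 ^ n) * ((M * N) * Q ^ (m + n))"
      using F(1) G(1) Q by (intro mult_right_mono mult_mono Suc_le_two_power) auto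
    also have "\<dots> = (M * N) * (2 * Q) ^ (m + n)" by (simp add: power_add power_mult_distrib)
    finally show ?thesis .
  qed
  then show ?thesis unfolding convergent2_iff_bound using Q
    by (intro exI[of _ "M * N"] exI[of _ "2 * Q"]) auto
qed

lemma convergent2_deriv_X:
  assumes "convergent2 F"
  shows "convergent2 (fps_deriv F)"
proof -
  obtain M R where F: "M \<ge> 0" "R \<ge> 1" "\<And>R' m n. R' \<ge> R \<Longrightarrow> norm (F $ m $ n) \<le> M * R' ^ (m + n)"
    using convergent2_obtain[OF assms(1)] by metis
  have "norm (fps_deriv F $ m $ n) \<le> (M * R) * (2 * R) ^ (m + n)" for m n
  proof -
    have "fps_deriv F $ m $ n = of_nat (Suc m) * F $ Suc m $ n"
      by (simp add: fps_of_nat[symmetric] del: of_nat_Suc)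
    then have "norm (fps_deriv F $ m $ n) = real (Suc m) * norm (F $ Suc m $ n)"
      by (simp only: norm_mult norm_of_nat)
    also have "\<dots> \<le> 2 ^ m * (M * R ^ (Suc m + n))"
      by (intro mult_mono Suc_le_two_power F(3)) auto
    also have "\<dots> \<le> 2 ^ (m + n) * (M * R ^ (Suc m + n))"
      using F(1,2) by (intro mult_right_mono power_increasing) auto
    also have "\<dots> = (M * R) * (2 * R) ^ (m + n)" by (simp add: power_mult_distrib)
    finally show ?thesis .
  qed
  then show ?thesis unfolding convergent2_iff_bound using F(2)
    by (intro exI[of _ "M * R"] exI[of _ "2 * R"]) auto
qed

lemma convergent2_deriv_Y:
  assumes "convergent2 F"
  shows "convergent2 (Abs_fps (\<lambda>m. fps_deriv (F $ m)))"
proof -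
  obtain M R where F: "M \<ge> 0" "R \<ge> 1" "\<And>R' m n. R' \<ge> R \<Longrightarrow> norm (F $ m $ n) \<le> M * R' ^ (m + n)"
    using convergent2_obtain[OF assms(1)] by metis
  have "norm (Abs_fps (\<lambda>m. fps_deriv (F $ m)) $ m $ n) \<le> (M * R) * (2 * R) ^ (m + n)" for m n
  proof -
    have "norm (Abs_fps (\<lambda>m. fps_deriv (F $ m)) $ m $ n) = real (Suc n) * norm (F $ m $ Suc n)"
      by (simp add: norm_mult del: of_nat_Suc)
    also have "\<dots> \<le> 2 ^ n * (M * R ^ (m + Suc n))"
      by (intro mult_mono Suc_le_two_power F(3)) auto
    also have "\<dots> \<le> 2 ^ (m + n) * (M * R ^ (m + Suc n))"
      using F(1,2) by (intro mult_right_mono power_increasing) auto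
    also have "\<dots> = (M * R) * (2 * R) ^ (m + n)" by (simp add: power_mult_distrib)
    finally show ?thesis .
  qed
  then show ?thesis unfolding convergent2_iff_bound using F(2)
    by (intro exI[of _ "M * R"] exI[of _ "2 * R"]) auto
qed

typedef conv2 = "{F :: complex fps fps. convergent2 F}"
  by (rule exI[of _ 0]) (simp add: convergent2_zero)

setup_lifting type_definition_conv2

instantiation conv2 :: idom
begin

lift_definition zero_conv2 :: conv2 is 0 by (rule convergent2_zero)
lift_definition one_conv2 :: conv2 is 1 by (rule convergent2_one)
lift_definition uminus_conv2 :: "conv2 \<Rightarrow> conv2" is uminus by (rule convergent2_uminus)
lift_definition plus_conv2 :: "conv2 \<Rightarrow> conv2 \<Rightarrow> conv2" is plus by (rule convergent2_add)
lift_definition minus_conv2 :: "conv2 \<Rightarrow> conv2 \<Rightarrow> conv2" is minus by (rule convergent2_diff)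
lift_definition times_conv2 :: "conv2 \<Rightarrow> conv2 \<Rightarrow> conv2" is times by (rule convergent2_mult)

instance
  by (standard; transfer) (auto simp: algebra_simps)

end

lift_definition const2 :: "complex \<Rightarrow> conv2" is "\<lambda>c. fps_const (fps_const c)"
  by (rule convergent2_const)

lift_definition deriv_X :: "conv2 \<Rightarrow> conv2" is fps_deriv
  by (rule convergent2_deriv_X)

lift_definition deriv_Y :: "conv2 \<Rightarrow> conv2" is "\<lambda>F. Abs_fps (\<lambda>m. fps_deriv (F $ m))"
  by (rule convergent2_deriv_Y)

text \<open>The ideal generated by \<open>S\<close> is the span of \<open>S\<close> in the ring viewed as a module over itself.\<close>

definition ideal_gen :: "conv2 set \<Rightarrow> conv2 set" where
  "ideal_gen S = module.span (*) S"

text \<open>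
  The residue classes of the elements of \<open>B\<close> modulo the ideal \<open>W\<close> are pairwise distinct and form
  a \<open>\<complex>\<close>-basis of \<open>\<complex>{X,Y}/W\<close>: every residue class is a linear combination of them in a unique
  way.  (Coefficient families live in an extensional function space, so that uniqueness is
  meaningful.)
\<close>

definition residue_basis :: "conv2 set \<Rightarrow> conv2 set \<Rightarrow> bool" where
  "residue_basis W B \<longleftrightarrow>
     (\<forall>v. \<exists>!c. c \<in> B \<rightarrow>\<^sub>E (UNIV :: complex set) \<and> v - (\<Sum>b\<in>B. const2 (c b) * b) \<in> W)"

text \<open>
  All finite bases have the same number of elements, so the infimum is that number, and it is
  \<open>\<infinity>\<close> (the infimum of the empty set) if the quotient is infinite-dimensional.
\<close>

definition quot_dim :: "conv2 set \<Rightarrow> enat" where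
  "quot_dim W = (INF B \<in> {B. finite B \<and> residue_basis W B}. enat (card B))"

definition tjurina :: "conv2 \<Rightarrow> enat" where
  "tjurina g = quot_dim (ideal_gen {g, deriv_X g, deriv_Y g})"

definition intersection_mult :: "conv2 \<Rightarrow> conv2 \<Rightarrow> enat" where
  "intersection_mult g h = quot_dim (ideal_gen {g, h})"

definition ecard :: "'a set \<Rightarrow> enat" where
  "ecard A = (if finite A then enat (card A) else \<infinity>)"

definition conv1 :: "complex fps set" where
  "conv1 = {u. fps_conv_radius u > 0}"

text \<open>
  For an irreducible \<open>h\<close>, the map \<open>\<phi>\<close> identifies \<open>\<complex>{t} = conv1\<close> with the normalization of
  \<open>\<complex>{X,Y}/\<langle>h\<rangle>\<close>: it is a homomorphism of \<open>\<complex>\<close>-algebras into \<open>\<complex>{t}\<close> with kernel \<open>\<langle>h\<rangle>\<close>, so that its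
  range is a copy of \<open>\<complex>{X,Y}/\<langle>h\<rangle>\<close>, and \<open>\<complex>{t}\<close> lies in the fraction field of this range and is
  integral over it.  (\<open>\<complex>{t}\<close> is itself integrally closed, so it is then the integral closure.)
\<close>

definition normalization :: "conv2 \<Rightarrow> (conv2 \<Rightarrow> complex fps) \<Rightarrow> bool" where
  "normalization h \<phi> \<longleftrightarrow>
     (\<forall>a b. \<phi> (a + b) = \<phi> a + \<phi> b) \<and>
     (\<forall>a b. \<phi> (a * b) = \<phi> a * \<phi> b) \<and>
     (\<forall>c. \<phi> (const2 c) = fps_const c) \<and>
     range \<phi> \<subseteq> conv1 \<and>
     (\<forall>a. \<phi> a = 0 \<longleftrightarrow> a \<in> ideal_gen {h}) \<and>
     (\<forall>u\<in>conv1. \<exists>a b. \<phi> b \<noteq> 0 \<and> u * \<phi> b = \<phi> a) \<and>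
     (\<forall>u\<in>conv1. \<exists>p :: complex fps poly.
        lead_coeff p = 1 \<and> set (coeffs p) \<subseteq> range \<phi> \<and> poly p u = 0)"

text \<open>
  Let \<open>f = \<Prod>\<^sub>i\<^sub>\<in>\<^sub>I f\<^sub>i\<close> and let \<open>\<phi> i\<close> be a normalization of the branch \<open>f\<^sub>i\<close>.  Elements of
  \<open>\<K> = \<Prod>\<^sub>i\<^sub>\<in>\<^sub>I \<K>\<^sub>i\<close> are families of Laurent series indexed by \<open>I\<close> (extensional functions), and the
  projection \<open>\<pi>\<^sub>i\<close> is evaluation at \<open>i\<close>.  The map \<open>germ I \<phi>\<close> sends a power series to its class in
  \<open>\<O> = \<complex>{X,Y}/\<langle>f\<rangle> \<subseteq> \<K>\<close>; its kernel is \<open>\<Inter>\<^sub>i\<^sub>\<in>\<^sub>I \<langle>f\<^sub>i\<rangle> = \<langle>f\<rangle>\<close> for pairwise non-associated irreducible \<open>f\<^sub>i\<close>.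
\<close>

definition germ :: "nat set \<Rightarrow> (nat \<Rightarrow> conv2 \<Rightarrow> complex fps) \<Rightarrow> conv2 \<Rightarrow> nat \<Rightarrow> complex fls" where
  "germ I \<phi> a = (\<lambda>i\<in>I. fps_to_fls (\<phi> i a))"

definition local_ring :: "nat set \<Rightarrow> (nat \<Rightarrow> conv2 \<Rightarrow> complex fps) \<Rightarrow> (nat \<Rightarrow> complex fls) set" where
  "local_ring I \<phi> = range (germ I \<phi>)"

definition jacobian_ideal ::
    "nat set \<Rightarrow> (nat \<Rightarrow> conv2 \<Rightarrow> complex fps) \<Rightarrow> conv2 \<Rightarrow> (nat \<Rightarrow> complex fls) set" where
  "jacobian_ideal I \<phi> f =
     {(\<lambda>i\<in>I. A i * germ I \<phi> (deriv_X f) i + B i * germ I \<phi> (deriv_Y f) i) | A B.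
        A \<in> local_ring I \<phi> \<and> B \<in> local_ring I \<phi>}"

definition vanishing_part :: "(nat \<Rightarrow> complex fls) set \<Rightarrow> nat set \<Rightarrow> (nat \<Rightarrow> complex fls) set" where
  "vanishing_part E L = {z \<in> E. \<forall>l\<in>L. z l = 0}"

text \<open>The \<open>t\<close>-adic order, with value \<open>\<infinity>\<close> at \<open>0\<close> (where \<^const>\<open>fls_subdegree\<close> is \<open>0\<close>).\<close>

definition t_order :: "complex fls \<Rightarrow> int extended" where
  "t_order z = (if z = 0 then Pinf else Fin (fls_subdegree z))"

definition order_set :: "nat \<Rightarrow> (nat \<Rightarrow> complex fls) set \<Rightarrow> int extended set" where
  "order_set i E = (\<lambda>z. t_order (z i)) ` E"

end

theory Submission
  imports Defs "HOL-Library.Set_Algebras"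
begin

text \<open>
  Write \<open>g\<close>, \<open>h\<close> for the equations of \<open>C\<^sub>J\<close>, \<open>C\<^sub>K\<close>, so that \<open>f = g h\<close>, and let \<open>T = \<langle>f, f\<^sub>X, f\<^sub>Y\<rangle>\<close>.
  Modulo \<open>g\<close> the ideal \<open>T\<close> becomes \<open>\<langle>h g\<^sub>X, h g\<^sub>Y\<rangle>\<close>, and since \<open>h\<close> is a nonzerodivisor modulo \<open>g\<close> the
  codimension of \<open>T + \<langle>g\<rangle>\<close> is \<open>I(g, h) + \<tau>(g)\<close>. Division by \<open>g\<close> identifies \<open>(T + \<langle>g\<rangle>) / T\<close> with the
  quotient of \<open>\<complex>{X,Y}\<close> by \<open>{u. g u \<in> T}\<close>, an ideal contained in \<open>\<langle>h, h\<^sub>X, h\<^sub>Y\<rangle>\<close>; this contributes \<open>\<tau>(h)\<close> and the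
  dimension of \<open>T / (T \<inter> \<langle>g\<rangle> + T \<inter> \<langle>h\<rangle>)\<close>. Filter the latter by the subspaces of the elements that
  vanish on \<open>f\<^sub>j\<^sub>+\<^sub>1, ..., f\<^sub>k\<^sub>-\<^sub>1\<close>. The graded piece for \<open>k\<close> is a quotient of two subspaces of
  \<open>\<complex>{t\<^sub>k}\<close>, and its dimension is the number of orders that occur only in the larger one, because
  the smaller one contains all series of large order: it is a nonzero ideal of \<open>\<O>\<^sub>k\<close>, and \<open>\<O>\<^sub>k\<close> has
  a conductor, as \<open>\<complex>{t\<^sub>k}\<close> is a finite module over \<open>\<complex>{x}\<close> for every nonzero nonunit \<open>x \<in> \<O>\<^sub>k\<close>.
\<close>

section \<open>Codimension of subspaces\<close>

lemma ecard_image: "inj_on p B \<Longrightarrow> ecard (p ` B) = ecard B"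
  by (simp add: ecard_def finite_image_iff card_image)

text \<open>
  Definitions placed in \<^locale>\<open>vector_space\<close> itself would be shadowed by those that its
  interpretation for real vector spaces generates.
\<close>

locale vector_space_codim = vector_space
begin

text \<open>A basis of \<open>U/W\<close> represented by vectors of \<open>U\<close>; the trivial
  intersection of \<open>span B\<close> with \<open>W\<close> keeps the classes independent.\<close>

definition relbasis :: "'b set \<Rightarrow> 'b set \<Rightarrow> 'b set \<Rightarrow> bool" where
  "relbasis U W B \<longleftrightarrow>
     independent B \<and> span B \<inter> W \<subseteq> {0} \<and> B \<subseteq> U \<and> (\<forall>u\<in>U. \<exists>b\<in>span B. u - b \<in> W)"

text \<open>For \<open>W\<close> inside \<open>U\<close> this is the dimension of
  \<open>U/W\<close>, and it is infinite when there is no finite relative basis. The form copies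
  that of \<open>quot_dim\<close>.\<close>

definition reldim :: "'b set \<Rightarrow> 'b set \<Rightarrow> enat" where
  "reldim U W = (INF B \<in> {B. finite B \<and> relbasis U W B}. enat (card B))"

text \<open>Extend a basis \<open>A\<close> of \<open>W\<close> to a basis \<open>C\<close> of
  \<open>U\<close>; the added vectors span a complement of \<open>W\<close> in
  \<open>U\<close>.\<close>

lemma relbasis_exists:
  assumes W: "subspace W" and U: "subspace U" and WU: "W \<subseteq> U"
  obtains B where "relbasis U W B"
proof -
  obtain A where A: "A \<subseteq> W" "independent A" "W \<subseteq> span A"
    using maximal_independent_subset by blast
  have sA: "span A = W" using A W by (simp add: span_subspace)
  obtain C where C: "A \<subseteq> C" "C \<subseteq> U" "independent C" "U \<subseteq> span C"
    using maximal_independent_subset_extend[of A U] A WU by blast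
  have sC: "span C = U" using C U by (simp add: span_subspace)
  define B where "B = C - A"
  have "span B \<inter> W \<subseteq> {0}"
  proof
    fix x assume x: "x \<in> span B \<inter> W"
    then have "x \<in> span A" by (simp add: sA)
    \<comment> \<open>A vector in both spans has the same coordinates over \<open>C\<close> as over
      \<open>A\<close> and over \<open>B\<close>. As \<open>A\<close> and \<open>B\<close> are
      disjoint, all of them vanish.\<close>
    have r: "representation C x = representation A x" "representation C x = representation B x"
      using x C(1) C(3) sA by (auto intro!: representation_extend simp: B_def)
    have "representation C x b = 0" for b
      using representation_ne_zero[of A x b] representation_ne_zero[of B x b] r
      by (auto simp: B_def)
    moreover have "x \<in> span C" using x C(1) sA span_mono by blast
    ultimately have "(\<Sum>b | representation C x b \<noteq> 0. scale (representation C x b) b) = x"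
      using C(3) by (intro sum_nonzero_representation_eq) auto
    then show "x \<in> {0}" using \<open>\<And>b. representation C x b = 0\<close> by simp
  qed
  moreover have "\<exists>b\<in>span B. u - b \<in> W" if "u \<in> U" for u
  proof -
    have "u \<in> span (A \<union> B)" using that C(1) sC by (simp add: B_def Un_absorb1)
    then show ?thesis unfolding span_Un sA by force
  qed
  ultimately have "relbasis U W B"
    unfolding relbasis_def using C(2) independent_mono[OF C(3), of B] by (auto simp: B_def)
  then show thesis by (rule that)
qed

text \<open>\<open>ker\<close> and \<open>surj\<close> say that \<open>p\<close> induces an
  isomorphism of the quotients. On \<open>span B\<close> it is injective even before passing to
  classes, because \<open>span B\<close> meets \<open>W\<close> only in 0.\<close>

lemma relbasis_map:
  assumes "Vector_Spaces.linear scale scale p"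
    and B: "relbasis U W B"
    and U: "subspace U" and W': "subspace W'"
    and pU: "\<And>x. x \<in> U \<Longrightarrow> p x \<in> U'"
    and ker: "\<And>x. x \<in> U \<Longrightarrow> p x \<in> W' \<longleftrightarrow> x \<in> W"
    and surj: "\<And>y. y \<in> U' \<Longrightarrow> \<exists>x\<in>U. y - p x \<in> W'"
  shows "relbasis U' W' (p ` B)" "inj_on p B"
proof -
  interpret p: Vector_Spaces.linear scale scale p by fact
  have BU: "span B \<subseteq> U" using B U by (simp add: relbasis_def span_minimal)
  have 0: "x = 0" if "x \<in> span B" "p x \<in> W'" for x
    using B that BU ker by (auto simp: relbasis_def)
  have inj: "inj_on p (span B)"
    by (subst p.inj_on_iff_eq_0) (use 0 W' subspace_0 in auto)
  show "inj_on p B" using inj inj_on_subset span_superset by blast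
  have "\<exists>b\<in>span (p ` B). u - b \<in> W'" if u: "u \<in> U'" for u
  proof -
    obtain x where x: "x \<in> U" "u - p x \<in> W'" using surj u by blast
    obtain b where b: "b \<in> span B" "x - b \<in> W" using B x by (auto simp: relbasis_def)
    have "x - b \<in> U" using x b BU U subspace_diff by blast
    then have "p (x - b) \<in> W'" using ker b by blast
    then have "(u - p x) + (p x - p b) \<in> W'"
      using x W' by (metis p.diff subspace_add)
    then show ?thesis using b by (auto simp: p.span_image intro!: bexI[of _ b])
  qed
  moreover have "span (p ` B) \<inter> W' \<subseteq> {0}" using 0 p.zero unfolding p.span_image by fastforce
  ultimately show "relbasis U' W' (p ` B)"
    unfolding relbasis_def
    using B pU p.independent_injective_image[OF _ inj] by (auto simp: relbasis_def)
qed

text \<open>If \<open>q\<close> projects onto \<open>W\<close>, then the identity minus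
  \<open>q\<close> has kernel exactly \<open>W\<close>. Its image serves as a model of the quotient
  by \<open>W\<close>.\<close>

lemma projection_exists:
  assumes "subspace W"
  obtains p where "Vector_Spaces.linear scale scale p" "\<And>x. p x = 0 \<longleftrightarrow> x \<in> W"
proof -
  interpret vector_space_pair scale scale ..
  obtain A where A: "A \<subseteq> W" "independent A" "W \<subseteq> span A"
    using maximal_independent_subset by blast
  have sA: "span A = W" using A assms by (simp add: span_subspace)
  obtain q where q: "Vector_Spaces.linear scale scale q" "q ` UNIV \<subseteq> span A" "\<forall>x\<in>span A. q x = x"
    using linear_exists_left_inverse_on[of id "span A"] linear_id
    by auto
  show thesis
  proof
    show "Vector_Spaces.linear scale scale (\<lambda>x. x - q x)"
      using q(1) by (intro linear_compose_sub linear_ident)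
    show "x - q x = 0 \<longleftrightarrow> x \<in> W" for x
      using q sA by (metis eq_iff_diff_eq_0 image_subset_iff UNIV_I)
  qed
qed

lemma relbasis_card:
  assumes "subspace U" "subspace W" "relbasis U W B" "relbasis U W C" "finite B"
  shows "finite C" "card C = card B"
proof -
  obtain p where p: "Vector_Spaces.linear scale scale p" "\<And>x. p x = 0 \<longleftrightarrow> x \<in> W"
    using projection_exists assms(2) by blast
  have *: "relbasis (p ` U) {0} (p ` D)" "inj_on p D" if "relbasis U W D" for D
    using relbasis_map[OF p(1) that assms(1), of "{0}" "p ` U"] p(2) by auto
  have **: "independent (p ` D)" "p ` D \<subseteq> p ` U" "p ` U \<subseteq> span (p ` D)" if "relbasis U W D" for D
    using *[OF that] by (auto simp: relbasis_def)
  have fin: "finite (p ` C)"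
    using independent_span_bound[of "p ` B" "p ` C"] ** assms by blast
  show "finite C" using fin *(2)[OF assms(4)] by (simp add: finite_image_iff)
  have "card (p ` C) = card (p ` B)"
    using basis_card_eq_dim[OF **(2,3,1)] assms by simp
  then show "card C = card B" using *(2) assms by (simp add: card_image)
qed

lemma reldim_eq:
  assumes "subspace U" "subspace W" "relbasis U W B"
  shows "reldim U W = ecard B"
proof (cases "finite B")
  case True
  have "reldim U W = enat (card B)"
    unfolding reldim_def
  proof (rule antisym)
    show "(INF B \<in> {B. finite B \<and> relbasis U W B}. enat (card B)) \<le> enat (card B)"
      using True assms(3) by (intro INF_lower) auto
    show "enat (card B) \<le> (INF B \<in> {B. finite B \<and> relbasis U W B}. enat (card B))"
    proof (rule INF_greatest)
      fix C assume "C \<in> {B. finite B \<and> relbasis U W B}"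
      then show "enat (card B) \<le> enat (card C)"
        using relbasis_card(2)[OF assms(1,2,3) _ True, of C] by simp
    qed
  qed
  then show ?thesis using True by (simp add: ecard_def)
next
  case False
  \<comment> \<open>A finite relative basis would force \<open>B\<close> to be finite, so the
    infimum is over the empty set and equals infinity.\<close>
  then have "\<not> relbasis U W C" if "finite C" for C
    using relbasis_card(1)[OF assms(1,2) _ assms(3) that] by blast
  then have none: "{B. finite B \<and> relbasis U W B} = {}" by blast
  show ?thesis using False unfolding reldim_def ecard_def none by (simp add: top_enat_def)
qed

text \<open>Every isomorphism of quotients below, whether induced by multiplication by a series or
  by an inclusion, is an instance of this.\<close>

lemma reldim_map:
  assumes "Vector_Spaces.linear scale scale p" and WU: "W \<subseteq> U"
    and U: "subspace U" and W: "subspace W" and U': "subspace U'" and W': "subspace W'"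
    and pU: "\<And>x. x \<in> U \<Longrightarrow> p x \<in> U'"
    and ker: "\<And>x. x \<in> U \<Longrightarrow> p x \<in> W' \<longleftrightarrow> x \<in> W"
    and surj: "\<And>y. y \<in> U' \<Longrightarrow> \<exists>x\<in>U. y - p x \<in> W'"
  shows "reldim U' W' = reldim U W"
proof -
  obtain B where B: "relbasis U W B" using relbasis_exists U W WU by blast
  note m = relbasis_map[OF assms(1) B U W' pU ker surj]
  show ?thesis
    using reldim_eq[OF U' W' m(1)] reldim_eq[OF U W B] m(2) by (simp add: ecard_image)
qed

text \<open>Relative bases of \<open>T/U\<close> and of \<open>U/W\<close> together form one of
  \<open>T/W\<close>: a combination of the first lies in \<open>U\<close> only if it is 0. Infinite
  dimensions are included.\<close>

lemma reldim_add:
  assumes T: "subspace T" and U: "subspace U" and W: "subspace W" and "W \<subseteq> U" "U \<subseteq> T"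
  shows "reldim T W = reldim T U + reldim U W"
proof -
  obtain B where B: "relbasis T U B" using relbasis_exists T U assms(5) by blast
  obtain C where C: "relbasis U W C" using relbasis_exists U W assms(4) by blast
  have CU: "span C \<subseteq> U" using C U by (simp add: relbasis_def span_minimal)
  have B0: "x = 0" if "x \<in> span B" "x \<in> U" for x using B that by (auto simp: relbasis_def)
  have C0: "x = 0" if "x \<in> span C" "x \<in> W" for x using C that by (auto simp: relbasis_def)
  have indB: "independent B" and indC: "independent C" using B C by (auto simp: relbasis_def)
  have disj: "B \<inter> C = {}"
  proof (rule ccontr)
    assume "B \<inter> C \<noteq> {}"
    then obtain x where x: "x \<in> B" "x \<in> C" by blast
    then have "x = 0" using B0 C by (auto simp: relbasis_def span_base)
    then show False using x indB dependent_zero by blast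
  qed
  have "independent (B \<union> C)"
    unfolding dependent_def
  proof
    assume "\<exists>a\<in>B \<union> C. a \<in> span (B \<union> C - {a})"
    then obtain a where a: "a \<in> B \<union> C" "a \<in> span ((B - {a}) \<union> (C - {a}))"
      by (auto simp: Un_Diff)
    then obtain x y where xy: "x \<in> span (B - {a})" "y \<in> span (C - {a})" "a = x + y"
      unfolding span_Un by blast
    have x: "x \<in> span B" and y: "y \<in> span C" using xy span_mono[of "B - {a}" B] span_mono[of "C - {a}" C] by auto
    show False
    proof (cases "a \<in> B")
      case True
      then have "a - x \<in> span B" using x span_base span_diff by blast
      moreover have "a - x \<in> U" using xy CU y by auto
      ultimately have "a = x" using B0 by fastforce
      then show False using True xy indB unfolding dependent_def by blast
    next
      case False
      then have "a \<in> C" using a by blast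
      then have "a - y \<in> U" using y CU U span_base span_diff by blast
      then have "x = 0" using B0 x xy by simp
      then show False using \<open>a \<in> C\<close> xy indC unfolding dependent_def by auto
    qed
  qed
  moreover have "span (B \<union> C) \<inter> W \<subseteq> {0}"
  proof
    fix z assume z: "z \<in> span (B \<union> C) \<inter> W"
    then obtain x y where xy: "x \<in> span B" "y \<in> span C" "z = x + y" unfolding span_Un by blast
    then have "z - y \<in> U" using z CU assms(4) U subspace_diff by blast
    then have "x = 0" using B0 xy by simp
    then show "z \<in> {0}" using C0 xy z by simp
  qed
  moreover have "\<exists>b\<in>span (B \<union> C). u - b \<in> W" if u: "u \<in> T" for u
  proof -
    obtain b where b: "b \<in> span B" "u - b \<in> U" using B u by (auto simp: relbasis_def)
    obtain c where c: "c \<in> span C" "u - b - c \<in> W" using C b by (auto simp: relbasis_def)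
    show ?thesis
      using b c by (intro bexI[of _ "b + c"]) (auto simp: span_Un algebra_simps)
  qed
  ultimately have "relbasis T W (B \<union> C)"
    using B C assms(5) by (auto simp: relbasis_def)
  then have "reldim T W = ecard (B \<union> C)" using reldim_eq T W by blast
  also have "\<dots> = ecard B + ecard C"
    using disj by (auto simp: ecard_def card_Un_disjoint)
  finally show ?thesis using reldim_eq B C T U W by simp
qed

lemma reldim_self: "subspace U \<Longrightarrow> reldim U U = 0"
  by (subst reldim_eq[of _ _ "{}"]) (auto simp: relbasis_def ecard_def subspace_0 zero_enat_def independent_empty)

lemma reldim_singleton:
  assumes "subspace U" "subspace W" "x \<in> U" "x \<notin> W" "\<And>u. u \<in> U \<Longrightarrow> \<exists>c. u - scale c x \<in> W"
  shows "reldim U W = 1"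
proof -
  have "scale c x \<in> W \<Longrightarrow> scale c x = 0" for c
    using subspace_scale[OF assms(2), of "scale c x" "inverse c"] assms(4) by (cases "c = 0") auto
  moreover have "x \<noteq> 0" using assms subspace_0 by blast
  ultimately have "relbasis U W {x}"
    using assms by (auto simp: relbasis_def span_singleton)
  then show ?thesis using assms by (simp add: reldim_eq ecard_def one_enat_def)
qed

text \<open>Telescoping of \<open>reldim_add\<close>. It is applied to the filtration by orders on
  one branch and to the filtration by the branches of \<open>C_K\<close>.\<close>

lemma reldim_chain:
  fixes V :: "nat \<Rightarrow> 'b set"
  assumes "\<And>n. subspace (V n)" "\<And>n. V (Suc n) \<subseteq> V n" "m \<le> n"
  shows "reldim (V m) (V n) = (\<Sum>k=m..<n. reldim (V k) (V (Suc k)))"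
  using assms(3)
proof (induction rule: dec_induct)
  case base
  then show ?case using assms reldim_self by simp
next
  case (step n)
  have "V n \<subseteq> V m" using lift_Suc_antimono_le[of V m n] assms(2) step by blast
  then have "reldim (V m) (V (Suc n)) = reldim (V m) (V n) + reldim (V n) (V (Suc n))"
    using assms by (intro reldim_add) auto
  then show ?case using step by simp
qed

end

section \<open>Ideals, quotient dimensions and intersection multiplicities\<close>

lemma const2_0 [simp]: "const2 0 = 0" by transfer simp
lemma const2_1 [simp]: "const2 1 = 1" by transfer simp
lemma const2_add: "const2 (a + b) = const2 a + const2 b" by transfer (simp flip: fps_const_add)
lemma const2_mult: "const2 (a * b) = const2 a * const2 b" by transfer (simp flip: fps_const_mult)

text \<open>Two structures are used side by side: the complex vector space, in which codimensions
  are taken, and the ring as a module over itself, whose subspaces are the ideals.\<close>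

interpretation conv2: vector_space_codim "\<lambda>c a. const2 c * a"
  by unfold_locales (auto simp: const2_add const2_mult algebra_simps)

interpretation conv2_ideal: module "(*) :: conv2 \<Rightarrow> conv2 \<Rightarrow> conv2"
  by unfold_locales (auto simp: algebra_simps)

declare conv2_ideal.scale_scale [simp del] \<comment> \<open>loops with associativity of multiplication\<close>

lemma subspace_if_ideal: "conv2_ideal.subspace I \<Longrightarrow> conv2.subspace I"
  by (auto simp: conv2_ideal.subspace_def conv2.subspace_def)

lemma linear_mult_conv2:
  "Vector_Spaces.linear (\<lambda>c a. const2 c * a) (\<lambda>c a. const2 c * a) ((*) (a :: conv2))"
  unfolding Vector_Spaces.linear_iff
  using conv2.vector_space_axioms by (simp add: distrib_left mult.left_commute)

lemma ideal_gen_ideal [simp]: "conv2_ideal.subspace (ideal_gen S)"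
  unfolding ideal_gen_def by simp

lemma ideal_gen_subspace [simp]: "conv2.subspace (ideal_gen S)"
  by (simp add: subspace_if_ideal)

lemma in_ideal_gen_1: "x \<in> ideal_gen {a} \<longleftrightarrow> a dvd x"
  by (auto simp: ideal_gen_def conv2_ideal.span_singleton dvd_def mult.commute)

lemma in_ideal_gen_2: "x \<in> ideal_gen {a, b} \<longleftrightarrow> (\<exists>u v. x = u * a + v * b)"
  unfolding ideal_gen_def conv2_ideal.span_breakdown_eq[of _ _ "{b}"] conv2_ideal.span_singleton
  by (auto simp: image_iff algebra_simps)

lemma in_ideal_gen_2I: "u * a + v * b \<in> ideal_gen {a, b}"
  unfolding in_ideal_gen_2 by blast

lemma in_ideal_gen_3: "x \<in> ideal_gen {a, b, c} \<longleftrightarrow> (\<exists>u v w. x = u * a + v * b + w * c)"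
  unfolding ideal_gen_def conv2_ideal.span_breakdown_eq[of _ _ "{b, c}"]
    conv2_ideal.span_breakdown_eq[of _ _ "{c}"] conv2_ideal.span_singleton
  by (auto simp: image_iff algebra_simps)

text \<open>Existence of coefficients is spanning modulo \<open>W\<close>; their uniqueness is
  independence together with trivial intersection with \<open>W\<close>.\<close>

lemma residue_basis_iff_relbasis:
  assumes W: "conv2.subspace W" and B: "finite B"
  shows "residue_basis W B \<longleftrightarrow> conv2.relbasis UNIV W B"
proof
  assume r: "residue_basis W B"
  have uniq: "c b = c' b" if "v - (\<Sum>b\<in>B. const2 (c b) * b) \<in> W" "v - (\<Sum>b\<in>B. const2 (c' b) * b) \<in> W" "b \<in> B" for v c c' b
  proof -
    have "\<exists>!d. d \<in> B \<rightarrow>\<^sub>E (UNIV :: complex set) \<and> v - (\<Sum>b\<in>B. const2 (d b) * b) \<in> W"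
      using r by (simp add: residue_basis_def)
    \<comment> \<open>Uniqueness is stated for extensional families, so arbitrary coefficients are
      first restricted to \<open>B\<close>.\<close>
    moreover have "restrict c B \<in> B \<rightarrow>\<^sub>E UNIV \<and> v - (\<Sum>b\<in>B. const2 (restrict c B b) * b) \<in> W"
      "restrict c' B \<in> B \<rightarrow>\<^sub>E UNIV \<and> v - (\<Sum>b\<in>B. const2 (restrict c' B b) * b) \<in> W"
      using that by auto
    ultimately have "restrict c B = restrict c' B" by blast
    then show ?thesis using that(3) by (metis restrict_apply')
  qed
  have zero: "c b = 0" if "(\<Sum>b\<in>B. const2 (c b) * b) \<in> W" "b \<in> B" for c b
    using uniq[of 0 c "\<lambda>_. 0" b] that conv2.subspace_neg[OF W] conv2.subspace_0[OF W] by simp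
  have "conv2.independent B"
    using zero conv2.subspace_0[OF W] unfolding conv2.dependent_finite[OF B] by force
  moreover have "conv2.span B \<inter> W \<subseteq> {0}"
    using zero const2_0 unfolding conv2.span_finite[OF B] by (fastforce intro!: sum.neutral)
  moreover have "\<exists>b\<in>conv2.span B. u - b \<in> W" for u
    using r unfolding conv2.span_finite[OF B] residue_basis_def by blast
  ultimately show "conv2.relbasis UNIV W B" by (simp add: conv2.relbasis_def)
next
  assume r: "conv2.relbasis UNIV W B"
  show "residue_basis W B"
    unfolding residue_basis_def
  proof
    fix v
    obtain b where b: "b \<in> conv2.span B" "v - b \<in> W"
      using r unfolding conv2.relbasis_def by blast
    then obtain c where c: "b = (\<Sum>b\<in>B. const2 (c b) * b)"
      unfolding conv2.span_finite[OF B] by blast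
    show "\<exists>!c. c \<in> B \<rightarrow>\<^sub>E (UNIV :: complex set) \<and> v - (\<Sum>b\<in>B. const2 (c b) * b) \<in> W"
    proof (rule ex1I[of _ "restrict c B"])
      show "restrict c B \<in> B \<rightarrow>\<^sub>E UNIV \<and> v - (\<Sum>b\<in>B. const2 (restrict c B b) * b) \<in> W"
        using b c by simp
    next
      fix d assume d: "d \<in> B \<rightarrow>\<^sub>E (UNIV :: complex set) \<and> v - (\<Sum>b\<in>B. const2 (d b) * b) \<in> W"
      let ?s = "\<Sum>b\<in>B. const2 (c b - d b) * b"
      have s: "?s = (v - (\<Sum>b\<in>B. const2 (d b) * b)) - (v - b)"
        by (simp add: c conv2.scale_left_diff_distrib sum_subtractf)
      then have "?s \<in> W" using b d conv2.subspace_diff[OF W] by metis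
      moreover have "?s \<in> conv2.span B" unfolding conv2.span_finite[OF B] by (rule range_eqI[where x = "\<lambda>b. c b - d b"]) (rule refl)
      ultimately have "?s = 0" using r by (auto simp: conv2.relbasis_def)
      then have "c x - d x = 0" if "x \<in> B" for x
        using r that conv2.independentD[OF _ B order.refl, of "\<lambda>b. c b - d b" x]
        by (auto simp: conv2.relbasis_def)
      then show "d = restrict c B" using d by (auto simp: fun_eq_iff PiE_def extensional_def)
    qed
  qed
qed

lemma quot_dim_eq_reldim: "conv2.subspace W \<Longrightarrow> quot_dim W = conv2.reldim UNIV W"
  unfolding quot_dim_def conv2.reldim_def
  by (intro INF_cong) (auto simp: residue_basis_iff_relbasis)

lemma quot_dim_ideal_gen: "quot_dim (ideal_gen S) = conv2.reldim UNIV (ideal_gen S)"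
  by (simp add: quot_dim_eq_reldim)

lemma quot_dim_unit: "quot_dim (ideal_gen {1, h}) = 0"
proof -
  have "x \<in> ideal_gen {1, h}" for x
    unfolding in_ideal_gen_2 by (intro exI[of _ x] exI[of _ 0]) simp
  then have "ideal_gen {1, h} = UNIV" by blast
  then show ?thesis unfolding quot_dim_ideal_gen by (simp add: conv2.reldim_self)
qed

text \<open>Multiplication by \<open>g\<close> identifies the quotient by
  \<open>\<langle>g', h\<rangle>\<close> with \<open>\<langle>g, h\<rangle>\<close> modulo
  \<open>\<langle>g g', h\<rangle>\<close>; \<open>cancel\<close> gives injectivity. Then
  codimensions add along
  \<open>\<langle>g g', h\<rangle> \<subseteq> \<langle>g, h\<rangle>\<close>.\<close>

lemma intersection_mult_mult:
  assumes cancel: "\<And>x. h dvd g * x \<Longrightarrow> h dvd x"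
  shows "intersection_mult (g * g') h = intersection_mult g h + intersection_mult g' h"
proof -
  have sub: "ideal_gen {g * g', h} \<subseteq> ideal_gen {g, h}"
  proof
    fix x assume "x \<in> ideal_gen {g * g', h}"
    then obtain u v where "x = u * (g * g') + v * h" unfolding in_ideal_gen_2 by blast
    then have "x = (u * g') * g + v * h" by (simp add: ac_simps)
    then show "x \<in> ideal_gen {g, h}" by (simp only: in_ideal_gen_2I)
  qed
  have "conv2.reldim (ideal_gen {g, h}) (ideal_gen {g * g', h}) = conv2.reldim UNIV (ideal_gen {g', h})"
  proof (rule conv2.reldim_map[OF linear_mult_conv2])
    show "g * x \<in> ideal_gen {g, h}" for x
      unfolding in_ideal_gen_2 by (intro exI[of _ x] exI[of _ 0]) simp
    show "g * x \<in> ideal_gen {g * g', h} \<longleftrightarrow> x \<in> ideal_gen {g', h}" for x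
    proof
      assume "g * x \<in> ideal_gen {g * g', h}"
      then obtain u v where "g * x = u * (g * g') + v * h" unfolding in_ideal_gen_2 by blast
      then have "g * (x - u * g') = h * v" by (simp add: algebra_simps)
      then have "h dvd x - u * g'" using cancel dvdI by metis
      then obtain w where "x - u * g' = h * w" ..
      then have "x = u * g' + w * h" by (simp add: algebra_simps)
      then show "x \<in> ideal_gen {g', h}" unfolding in_ideal_gen_2 by blast
    next
      assume "x \<in> ideal_gen {g', h}"
      then obtain u v where "x = u * g' + v * h" unfolding in_ideal_gen_2 by blast
      then have "g * x = u * (g * g') + (g * v) * h" by (simp add: algebra_simps)
      then show "g * x \<in> ideal_gen {g * g', h}" unfolding in_ideal_gen_2 by blast
    qed
    show "\<exists>x\<in>UNIV. y - g * x \<in> ideal_gen {g * g', h}" if y: "y \<in> ideal_gen {g, h}" for y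
    proof -
      obtain u v where "y = u * g + v * h" using y unfolding in_ideal_gen_2 by blast
      then have "y - g * u = 0 * (g * g') + v * h" by (simp add: algebra_simps)
      then show ?thesis unfolding in_ideal_gen_2 by blast
    qed
  qed auto
  then show ?thesis
    unfolding intersection_mult_def quot_dim_ideal_gen
    using conv2.reldim_add[of UNIV "ideal_gen {g, h}" "ideal_gen {g * g', h}"] sub by simp
qed

lemma intersection_mult_commute: "intersection_mult g h = intersection_mult h g"
  by (simp add: intersection_mult_def insert_commute)

lemma intersection_mult_prod_left:
  assumes "finite A" "\<And>i x. i \<in> A \<Longrightarrow> h dvd f i * x \<Longrightarrow> h dvd x"
  shows "intersection_mult (\<Prod>i\<in>A. f i) h = (\<Sum>i\<in>A. intersection_mult (f i) h)"
  using assms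
proof (induction A rule: finite_induct)
  case empty
  then show ?case by (simp add: intersection_mult_def quot_dim_unit)
next
  case (insert a A)
  have "intersection_mult (f a * prod f A) h = intersection_mult (f a) h + intersection_mult (prod f A) h"
    by (rule intersection_mult_mult) (use insert.prems in blast)
  moreover have "intersection_mult (prod f A) h = (\<Sum>i\<in>A. intersection_mult (f i) h)"
    by (rule insert.IH) (use insert.prems in blast)
  ultimately show ?case using insert.hyps by simp
qed

section \<open>Divisibility by products of primes\<close>

lemma prime_elem_dvd_prod_cancel:
  fixes p :: "'a :: comm_semiring_1"
  assumes "prime_elem p" "\<And>i. i \<in> A \<Longrightarrow> \<not> p dvd f i" "p dvd prod f A * x"
  shows "p dvd x"
  using assms(2,3)
proof (induction A rule: infinite_finite_induct)
  case (insert a A)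
  then have "p dvd f a * (prod f A * x)" by (simp add: ac_simps)
  then have "p dvd prod f A * x" using insert.prems(1)[of a] prime_elem_dvd_mult_iff[OF assms(1)] by blast
  then show ?case using insert by blast
qed auto

text \<open>Write \<open>x\<close> as \<open>prod f A * y\<close>; the new prime divides no factor
  of \<open>prod f A\<close>, hence it divides \<open>y\<close>.\<close>

lemma prod_prime_elem_dvd:
  fixes f :: "'i \<Rightarrow> 'a :: comm_semiring_1"
  assumes "finite A" "\<And>i. i \<in> A \<Longrightarrow> prime_elem (f i)"
    "\<And>i l. i \<in> A \<Longrightarrow> l \<in> A \<Longrightarrow> i \<noteq> l \<Longrightarrow> \<not> f i dvd f l"
    "\<And>i. i \<in> A \<Longrightarrow> f i dvd x"
  shows "prod f A dvd x"
  using assms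
proof (induction A rule: finite_induct)
  case (insert a A)
  then have "prod f A dvd x" by blast
  then obtain y where y: "x = prod f A * y" ..
  moreover have "f a dvd prod f A * y" using insert.prems(3)[of a] y by simp
  moreover have "\<not> f a dvd f i" if "i \<in> A" for i
    using insert.prems(2)[of a i] insert.hyps that by auto
  ultimately have "f a dvd y"
    using prime_elem_dvd_prod_cancel[of "f a" A f y] insert.prems(1)[of a] by blast
  then show ?case using y insert.hyps by (simp add: mult.commute mult_dvd_mono)
qed simp

section \<open>Product rules, Tjurina ideals and sums of subspaces\<close>

lemma deriv_X_mult: "deriv_X (a * b) = a * deriv_X b + deriv_X a * b"
  by transfer simp

lemma deriv_Y_mult: "deriv_Y (a * b) = a * deriv_Y b + deriv_Y a * b"
proof (transfer, rule fps_ext)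
  fix a b :: "complex fps fps" and n
  show "Abs_fps (\<lambda>m. fps_deriv ((a * b) $ m)) $ n =
    (a * Abs_fps (\<lambda>m. fps_deriv (b $ m)) + Abs_fps (\<lambda>m. fps_deriv (a $ m)) * b) $ n"
    by (simp add: fps_mult_nth fps_deriv_sum sum.distrib)
qed

definition tjurina_ideal :: "conv2 \<Rightarrow> conv2 set" where
  "tjurina_ideal g = ideal_gen {g, deriv_X g, deriv_Y g}"

lemma tjurina_ideal_ideal [simp]: "conv2_ideal.subspace (tjurina_ideal g)"
  and tjurina_ideal_subspace [simp]: "conv2.subspace (tjurina_ideal g)"
  by (simp_all add: tjurina_ideal_def)

lemma tjurina_eq_reldim: "tjurina g = conv2.reldim UNIV (tjurina_ideal g)"
  by (simp add: tjurina_def tjurina_ideal_def quot_dim_ideal_gen)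

lemma in_tjurina_ideal:
  "x \<in> tjurina_ideal g \<longleftrightarrow> (\<exists>u v w. x = u * g + v * deriv_X g + w * deriv_Y g)"
  by (simp add: tjurina_ideal_def in_ideal_gen_3)

lemma in_set_plus_iff: "x \<in> A + B \<longleftrightarrow> (\<exists>a\<in>A. x - a \<in> B)" for x :: "'a :: ab_group_add"
proof
  assume "x \<in> A + B"
  then obtain a b where "a \<in> A" "b \<in> B" "x = a + b" by (rule set_plus_elim)
  then show "\<exists>a\<in>A. x - a \<in> B" by (intro bexI[of _ a]) auto
next
  assume "\<exists>a\<in>A. x - a \<in> B"
  then obtain a where "a \<in> A" "x - a \<in> B" by blast
  then show "x \<in> A + B" using set_plus_intro[of a A "x - a" B] by simp
qed

lemma set_plus_subspace:
  "conv2.subspace A \<Longrightarrow> conv2.subspace B \<Longrightarrow> conv2.subspace (A + B)"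
  using conv2.subspace_sums[of A B] by (simp add: set_plus_def Bex_def conj_ac)

section \<open>The Tjurina number of a product\<close>

lemma multiples_subspace [simp]: "conv2.subspace {x. g dvd x}"
  using ideal_gen_subspace[of "{g}"] by (simp add: in_ideal_gen_1[symmetric] del: ideal_gen_subspace)

text \<open>By the product rule, the derivatives of \<open>g * h\<close> are congruent to
  \<open>h\<close> times those of \<open>g\<close> modulo \<open>g\<close>.\<close>

lemma tjurina_ideal_plus_multiples:
  "x \<in> tjurina_ideal (g * h) + {x. g dvd x} \<longleftrightarrow>
    (\<exists>u v w. x = u * g + v * (h * deriv_X g) + w * (h * deriv_Y g))"
proof
  assume "x \<in> tjurina_ideal (g * h) + {x. g dvd x}"
  then obtain t where t1: "t \<in> tjurina_ideal (g * h)" "g dvd x - t"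
    unfolding in_set_plus_iff by blast
  then obtain k where t: "t \<in> tjurina_ideal (g * h)" "x - t = g * k" by (auto elim!: dvdE)
  then obtain a b c where "t = a * (g * h) + b * deriv_X (g * h) + c * deriv_Y (g * h)"
    unfolding in_tjurina_ideal by blast
  moreover have "x = t + g * k" using t(2) by (simp add: algebra_simps)
  ultimately have "x = (a * h + b * deriv_X h + c * deriv_Y h + k) * g
      + b * (h * deriv_X g) + c * (h * deriv_Y g)"
    by (simp add: deriv_X_mult deriv_Y_mult algebra_simps)
  then show "\<exists>u v w. x = u * g + v * (h * deriv_X g) + w * (h * deriv_Y g)" by metis
next
  assume "\<exists>u v w. x = u * g + v * (h * deriv_X g) + w * (h * deriv_Y g)"
  then obtain u v w where x: "x = u * g + v * (h * deriv_X g) + w * (h * deriv_Y g)" by metis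
  let ?t = "0 * (g * h) + v * deriv_X (g * h) + w * deriv_Y (g * h)"
  have "x - ?t = g * (u - v * deriv_X h - w * deriv_Y h)"
    by (simp add: x deriv_X_mult deriv_Y_mult algebra_simps)
  then have "g dvd x - ?t" by simp
  moreover have "?t \<in> tjurina_ideal (g * h)" unfolding in_tjurina_ideal by blast
  ultimately show "x \<in> tjurina_ideal (g * h) + {x. g dvd x}"
    by (metis in_set_plus_iff mem_Collect_eq)
qed

text \<open>Codimensions are added along
  \<open>T \<subseteq> G \<subseteq> \<langle>g, h\<rangle>\<close>. The upper two pieces give
  \<open>tjurina g\<close> and the intersection multiplicity; the piece \<open>G/T\<close> is the
  quotient by \<open>M\<close>, and \<open>M\<close> lies in \<open>tjurina_ideal h\<close>. The
  leftover \<open>tjurina_ideal h\<close> modulo \<open>M\<close> is carried to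
  \<open>T/(Q + P)\<close> through \<open>H/QH\<close>.\<close>

lemma tjurina_mult:
  fixes g h :: conv2
  defines "T \<equiv> tjurina_ideal (g * h)"
  assumes hg: "\<And>x. h dvd g * x \<Longrightarrow> h dvd x" and gh: "\<And>x. g dvd h * x \<Longrightarrow> g dvd x"
  shows "tjurina (g * h) = tjurina g + tjurina h + intersection_mult g h
    + conv2.reldim T ({x \<in> T. g dvd x} + {x \<in> T. h dvd x})"
proof -
  define G where "G = T + {x. g dvd x}"
  define H where "H = T + {x. h dvd x}"
  define Q where "Q = {x \<in> T. g dvd x}"
  define P where "P = {x \<in> T. h dvd x}"
  define QH where "QH = Q + {x. h dvd x}"
  define M where "M = {x. g * x \<in> T}"
  have T: "conv2.subspace T" by (simp add: T_def)
  have G: "conv2.subspace G" and H: "conv2.subspace H"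
    unfolding G_def H_def using T by (auto intro: set_plus_subspace)
  have Q: "conv2.subspace Q" and P: "conv2.subspace P"
    using conv2.subspace_inter[OF T multiples_subspace] by (auto simp: Q_def P_def Collect_conj_eq)
  have QH: "conv2.subspace QH" unfolding QH_def using Q by (auto intro: set_plus_subspace)
  have M: "conv2.subspace M"
    unfolding M_def using module_hom.subspace_linear_preimage[OF _ T] linear_mult_conv2
    unfolding Vector_Spaces.linear_def by blast
  have T0: "0 \<in> T" and Q0: "0 \<in> Q" using T Q conv2.subspace_0 by auto
  have inG: "x \<in> G \<longleftrightarrow> (\<exists>u v w. x = u * g + v * (h * deriv_X g) + w * (h * deriv_Y g))" for x
    unfolding G_def T_def by (rule tjurina_ideal_plus_multiples)
  have inH: "x \<in> H \<longleftrightarrow> (\<exists>u v w. x = u * h + v * (g * deriv_X h) + w * (g * deriv_Y h))" for x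
    unfolding H_def T_def using tjurina_ideal_plus_multiples[of x h g] by (simp only: mult.commute)
  have TG: "T \<subseteq> G" unfolding G_def by (rule subsetI) (force simp: in_set_plus_iff)
  have TH: "T \<subseteq> H" unfolding H_def by (rule subsetI) (force simp: in_set_plus_iff)
  have cancel_g: "x \<in> tjurina_ideal g" if hx: "h * x \<in> G" for x
  proof -
    obtain u v w where "h * x = u * g + v * (h * deriv_X g) + w * (h * deriv_Y g)"
      using hx inG by blast
    then have "h * (x - v * deriv_X g - w * deriv_Y g) = g * u" by (simp add: algebra_simps)
    then have "g dvd x - v * deriv_X g - w * deriv_Y g" using gh dvdI by metis
    then obtain k where "x - v * deriv_X g - w * deriv_Y g = g * k" ..
    then have "x = k * g + v * deriv_X g + w * deriv_Y g" by (simp add: algebra_simps)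
    then show ?thesis unfolding in_tjurina_ideal by blast
  qed
  have cancel_h: "x \<in> tjurina_ideal h" if gx: "g * x \<in> H" for x
  proof -
    obtain u v w where "g * x = u * h + v * (g * deriv_X h) + w * (g * deriv_Y h)"
      using gx inH by blast
    then have "g * (x - v * deriv_X h - w * deriv_Y h) = h * u" by (simp add: algebra_simps)
    then have "h dvd x - v * deriv_X h - w * deriv_Y h" using hg dvdI by metis
    then obtain k where "x - v * deriv_X h - w * deriv_Y h = h * k" ..
    then have "x = k * h + v * deriv_X h + w * deriv_Y h" by (simp add: algebra_simps)
    then show ?thesis unfolding in_tjurina_ideal by blast
  qed
  have G_gh: "G \<subseteq> ideal_gen {g, h}"
  proof
    fix x assume "x \<in> G"
    then obtain u v w where "x = u * g + v * (h * deriv_X g) + w * (h * deriv_Y g)"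
      using inG by blast
    then have "x = u * g + (v * deriv_X g + w * deriv_Y g) * h" by (simp add: algebra_simps)
    then show "x \<in> ideal_gen {g, h}" by (simp only: in_ideal_gen_2I)
  qed
  \<comment> \<open>Multiplication by \<open>h\<close> induces the isomorphism; \<open>gh\<close>
    makes it injective.\<close>
  have 1: "conv2.reldim (ideal_gen {g, h}) G = conv2.reldim UNIV (tjurina_ideal g)"
  proof (rule conv2.reldim_map[OF linear_mult_conv2])
    show "h * x \<in> ideal_gen {g, h}" for x
      using in_ideal_gen_2I[of 0 g x h] by (simp add: mult.commute)
    show "h * x \<in> G \<longleftrightarrow> x \<in> tjurina_ideal g" for x
    proof
      assume "x \<in> tjurina_ideal g"
      then obtain u v w where "x = u * g + v * deriv_X g + w * deriv_Y g"
        unfolding in_tjurina_ideal by blast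
      then have "h * x = (h * u) * g + v * (h * deriv_X g) + w * (h * deriv_Y g)"
        by (simp add: algebra_simps)
      then show "h * x \<in> G" using inG by blast
    qed (rule cancel_g)
    show "\<exists>x\<in>UNIV. y - h * x \<in> G" if y: "y \<in> ideal_gen {g, h}" for y
    proof -
      obtain u v where "y = u * g + v * h" using y unfolding in_ideal_gen_2 by blast
      then have "y - h * v = u * g + 0 * (h * deriv_X g) + 0 * (h * deriv_Y g)"
        by (simp add: algebra_simps)
      then show ?thesis using inG by blast
    qed
  qed (auto simp: G)
  have 2: "conv2.reldim G T = conv2.reldim UNIV M"
  proof (rule conv2.reldim_map[OF linear_mult_conv2])
    show "g * x \<in> G" for x
      using T0 unfolding G_def in_set_plus_iff by (intro bexI[of _ 0]) auto
    show "g * x \<in> T \<longleftrightarrow> x \<in> M" for x by (simp add: M_def)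
    show "\<exists>x\<in>UNIV. y - g * x \<in> T" if y: "y \<in> G" for y
    proof -
      obtain t k where "t \<in> T" "y - t = g * k"
        using y unfolding G_def in_set_plus_iff dvd_def by blast
      then have "y - g * k = t" by (simp add: algebra_simps)
      with \<open>t \<in> T\<close> show ?thesis by blast
    qed
  qed (auto simp: G T M)
  have M_Th: "M \<subseteq> tjurina_ideal h" using cancel_h TH by (auto simp: M_def)
  have 3: "conv2.reldim H QH = conv2.reldim (tjurina_ideal h) M"
  proof (rule conv2.reldim_map[OF linear_mult_conv2])
    show "g * x \<in> H" if x: "x \<in> tjurina_ideal h" for x
    proof -
      obtain u v w where "x = u * h + v * deriv_X h + w * deriv_Y h"
        using x unfolding in_tjurina_ideal by blast
      then have "g * x = (g * u) * h + v * (g * deriv_X h) + w * (g * deriv_Y h)"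
        by (simp add: algebra_simps)
      then show ?thesis using inH by blast
    qed
    show "g * x \<in> QH \<longleftrightarrow> x \<in> M" for x
    proof
      assume "g * x \<in> QH"
      then obtain s where s: "g * s \<in> T" "h dvd g * x - g * s"
        by (auto simp: QH_def Q_def in_set_plus_iff)
      then have "h dvd g * (x - s)" by (simp add: right_diff_distrib)
      then have "h dvd x - s" by (rule hg)
      then obtain k where "x - s = h * k" ..
      then have "x = s + h * k" by (simp add: algebra_simps)
      \<comment> \<open>The correction is a multiple of \<open>g * h\<close> and thus lies in
        \<open>T\<close>.\<close>
      then have gx: "g * x = g * s + (k * (g * h) + 0 * deriv_X (g * h) + 0 * deriv_Y (g * h))"
        by (simp add: algebra_simps)
      have "k * (g * h) + 0 * deriv_X (g * h) + 0 * deriv_Y (g * h) \<in> T"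
        unfolding T_def in_tjurina_ideal by blast
      then have "g * x \<in> T" unfolding gx using s(1) T conv2.subspace_add by blast
      then show "x \<in> M" by (simp add: M_def)
    next
      assume "x \<in> M"
      then show "g * x \<in> QH"
        unfolding QH_def in_set_plus_iff by (intro bexI[of _ "g * x"]) (auto simp: M_def Q_def)
    qed
    show "\<exists>x\<in>tjurina_ideal h. y - g * x \<in> QH" if y: "y \<in> H" for y
    proof -
      obtain u v w where y': "y = u * h + v * (g * deriv_X h) + w * (g * deriv_Y h)"
        using y inH by blast
      let ?x = "0 * h + v * deriv_X h + w * deriv_Y h"
      have "y - g * ?x = u * h" by (simp add: y' algebra_simps)
      then have "y - g * ?x \<in> QH"
        using Q0 unfolding QH_def in_set_plus_iff by (intro bexI[of _ 0]) auto
      moreover have "?x \<in> tjurina_ideal h" unfolding in_tjurina_ideal by blast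
      ultimately show ?thesis by blast
    qed
  qed (use M_Th H QH M in auto)
  \<comment> \<open>The map is the inclusion of \<open>T\<close> in \<open>H\<close>, written as
    multiplication by 1. It is onto modulo \<open>QH\<close>, which contains all multiples of
    \<open>h\<close>, and \<open>T\<close> meets \<open>QH\<close> in \<open>Q + P\<close> since
    \<open>Q\<close> lies in \<open>T\<close>.\<close>
  have 4: "conv2.reldim H QH = conv2.reldim T (Q + P)"
  proof (rule conv2.reldim_map[OF linear_mult_conv2[of 1]])
    show "1 * x \<in> H" if "x \<in> T" for x using TH that by auto
    show "1 * x \<in> QH \<longleftrightarrow> x \<in> Q + P" if "x \<in> T" for x
      using that conv2.subspace_diff[OF T] by (auto simp: QH_def in_set_plus_iff Q_def P_def)
    show "\<exists>x\<in>T. y - 1 * x \<in> QH" if y: "y \<in> H" for y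
    proof -
      obtain t where "t \<in> T" "h dvd y - t" using y by (auto simp: H_def in_set_plus_iff)
      then show ?thesis using Q0
        by (intro bexI[of _ t]) (auto simp: QH_def in_set_plus_iff intro!: bexI[of _ 0])
    qed
    show "Q + P \<subseteq> T" using conv2.subspace_add[OF T] by (auto simp: Q_def P_def elim!: set_plus_elim)
  qed (use T H QH Q P in \<open>auto intro: set_plus_subspace\<close>)
  have 5: "tjurina (g * h) = conv2.reldim UNIV G + conv2.reldim G T"
    unfolding tjurina_eq_reldim T_def[symmetric] using T G TG by (intro conv2.reldim_add) auto
  have 6: "conv2.reldim UNIV G = conv2.reldim UNIV (ideal_gen {g, h}) + conv2.reldim (ideal_gen {g, h}) G"
    using G G_gh by (intro conv2.reldim_add) auto
  have 7: "conv2.reldim UNIV M = conv2.reldim UNIV (tjurina_ideal h) + conv2.reldim (tjurina_ideal h) M"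
    using M M_Th by (intro conv2.reldim_add) auto
  show ?thesis
    unfolding 5 6 2 7 1 3[symmetric] 4 unfolding intersection_mult_def quot_dim_ideal_gen
      tjurina_eq_reldim Q_def P_def by (simp only: add.assoc add.commute add.left_commute)
qed

section \<open>Convergent power series in one variable and Weierstrass division\<close>

text \<open>The terms of a convergent series at a point are bounded; conversely, at
  \<open>1 / (2 * R)\<close> the terms are dominated by a geometric series. The estimates of the
  division use this form.\<close>

lemma conv1_iff_bound:
  "u \<in> conv1 \<longleftrightarrow> (\<exists>M R. R > 0 \<and> (\<forall>m. norm (u $ m) \<le> M * R ^ m))"
proof
  assume "u \<in> conv1"
  then have "0 < fps_conv_radius u" by (simp add: conv1_def)
  then obtain r where r: "0 < ereal r" "ereal r < fps_conv_radius u"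
    using ereal_dense2 by blast
  then have r0: "r > 0" by simp
  have "summable (\<lambda>n. u $ n * of_real r ^ n)"
    using r r0 by (intro summable_in_conv_radius) (simp add: fps_conv_radius_def)
  then have "bounded (range (\<lambda>n. u $ n * of_real r ^ n))"
    by (rule summable_imp_bounded)
  then obtain M where "\<And>n. norm (u $ n * of_real r ^ n) \<le> M"
    unfolding bounded_iff by blast
  then have "norm (u $ n) \<le> M * (1 / r) ^ n" for n
    using r0 by (simp add: norm_mult norm_power field_simps power_one_over)
  then show "\<exists>M R. R > 0 \<and> (\<forall>m. norm (u $ m) \<le> M * R ^ m)"
    using r0 by (intro exI[of _ M] exI[of _ "1 / r"]) auto
next
  assume "\<exists>M R. R > 0 \<and> (\<forall>m. norm (u $ m) \<le> M * R ^ m)"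
  then obtain M R where R: "R > 0" and b: "\<And>m. norm (u $ m) \<le> M * R ^ m" by blast
  define z :: complex where "z = of_real (1 / (2 * R))"
  have nz: "norm z = 1 / (2 * R)" using R by (simp add: z_def norm_divide norm_mult)
  have "norm (u $ n * z ^ n) \<le> M * (1 / 2) ^ n" for n
  proof -
    have "norm (u $ n * z ^ n) \<le> (M * R ^ n) * (1 / (2 * R)) ^ n"
      unfolding norm_mult norm_power nz using R by (intro mult_right_mono b) auto
    also have "\<dots> = M * (R * (1 / (2 * R))) ^ n" by (simp only: power_mult_distrib mult.assoc)
    also have "R * (1 / (2 * R)) = 1 / 2" using R by simp
    finally show ?thesis .
  qed
  moreover have "summable (\<lambda>n. M * (1 / 2) ^ n :: real)"
    by (intro summable_mult summable_geometric) simp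
  ultimately have "summable (\<lambda>n. u $ n * z ^ n)" by (meson summable_comparison_test')
  then have "ereal (norm z) \<le> fps_conv_radius u"
    unfolding fps_conv_radius_def by (rule conv_radius_geI)
  moreover have "0 < ereal (norm z)" using R by (simp add: nz)
  ultimately have "0 < fps_conv_radius u" by (metis less_le_trans)
  then show "u \<in> conv1" by (simp add: conv1_def)
qed

lemma conv1_mult: "u \<in> conv1 \<Longrightarrow> v \<in> conv1 \<Longrightarrow> u * v \<in> conv1"
  unfolding conv1_def using fps_conv_radius_mult[of u v]
  by (auto simp: min_def split: if_splits intro: less_le_trans)

lemma conv1_shift [simp]: "fps_shift n u \<in> conv1 \<longleftrightarrow> u \<in> conv1"
  by (simp add: conv1_def)

lemma conv1_inverse: "u \<in> conv1 \<Longrightarrow> u $ 0 \<noteq> 0 \<Longrightarrow> inverse u \<in> conv1"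
  by (simp add: conv1_def fps_conv_radius_inverse_pos)

lemma fps_X_in_conv1 [simp]: "fps_X \<in> conv1"
  by (simp add: conv1_def)

text \<open>Up to a convergent unit, \<open>d\<close> is a power of the variable, so orders alone
  decide divisibility.\<close>

lemma conv1_quotient:
  assumes "d \<in> conv1" "d \<noteq> 0" "v \<in> conv1" "subdegree d \<le> subdegree v"
  obtains u where "u \<in> conv1" "v = d * u"
proof
  let ?n = "subdegree d"
  let ?u = "fps_shift ?n v * inverse (fps_shift ?n d)"
  have nz: "fps_shift ?n d $ 0 \<noteq> 0" using assms(2) by simp
  show "?u \<in> conv1" using assms nz by (intro conv1_mult conv1_inverse) auto
  have "d * ?u = (fps_shift ?n d * fps_X ^ ?n) * ?u" by (simp flip: subdegree_decompose)
  also have "\<dots> = (inverse (fps_shift ?n d) * fps_shift ?n d) * (fps_shift ?n v * fps_X ^ ?n)"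
    by (simp only: ac_simps)
  also have "\<dots> = v"
    using assms(4) subdegree_decompose'[of ?n v] nz by (simp add: inverse_mult_eq_1)
  finally show "v = d * ?u" by simp
qed

text \<open>
  Weierstrass division by \<open>x\<close>, iterated. One division multiplies a bound \<open>C * R ^ m\<close> of the
  coefficients by a constant if \<open>R\<close> is large, so the remainders grow only geometrically.
\<close>

lemma division_bound:
  fixes v e :: "complex fps"
  assumes v: "\<And>m. norm (v $ m) \<le> C * R ^ m" and e: "\<And>m. norm (e $ m) \<le> N * S ^ m"
    and R: "2 * S \<le> R" and S: "S > 0"
  shows "norm ((fps_shift n v * e) $ m) \<le> (2 * N * R ^ n * C) * R ^ m"
proof -
  have C: "C \<ge> 0" using order.trans[OF norm_ge_zero v[of 0]] by simp
  have N: "N \<ge> 0" using order.trans[OF norm_ge_zero e[of 0]] by simp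
  have "norm ((fps_shift n v * e) $ m) \<le> (\<Sum>i=0..m. norm (v $ (i + n) * e $ (m - i)))"
    unfolding fps_mult_nth fps_shift_nth by (rule norm_sum)
  \<comment> \<open>Because \<open>2 * S \<le> R\<close>, each power of \<open>S\<close> costs a
    factor \<open>1/2\<close> against \<open>R\<close>; the remaining geometric sum is at most 2,
    independently of \<open>m\<close>.\<close>
  also have "\<dots> \<le> (\<Sum>i=0..m. C * N * R ^ n * R ^ m * (1/2) ^ (m - i))"
  proof (intro sum_mono)
    fix i assume i: "i \<in> {0..m}"
    have "norm (v $ (i + n) * e $ (m - i)) \<le> (C * R ^ (i + n)) * (N * (R / 2) ^ (m - i))"
      unfolding norm_mult
    proof (intro mult_mono v)
      have "N * S ^ (m - i) \<le> N * (R / 2) ^ (m - i)"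
        using R S N by (intro mult_left_mono power_mono) auto
      then show "norm (e $ (m - i)) \<le> N * (R / 2) ^ (m - i)" using e order.trans by blast
    qed (use C R S in auto)
    also have "\<dots> = C * N * R ^ n * R ^ (i + (m - i)) * (1/2) ^ (m - i)"
      by (simp add: power_add power_divide)
    finally show "norm (v $ (i + n) * e $ (m - i)) \<le> C * N * R ^ n * R ^ m * (1/2) ^ (m - i)"
      using i by simp
  qed
  also have "\<dots> = C * N * R ^ n * R ^ m * (\<Sum>i=0..m. (1/2) ^ (m - i))"
    by (simp add: sum_distrib_left)
  also have "(\<Sum>i=0..m. (1/2) ^ (m - i)) = (\<Sum>i=0..m. (1/2 :: real) ^ i)"
    using sum.atLeastAtMost_rev[of "\<lambda>i. (1/2 :: real) ^ i" 0 m] by simp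
  also have "C * N * R ^ n * R ^ m * (\<Sum>i=0..m. (1/2 :: real) ^ i) \<le> C * N * R ^ n * R ^ m * 2"
    using C N R S by (intro mult_left_mono) (simp_all add: sum_gp0 atLeast0AtMost)
  finally show ?thesis by (simp add: ac_simps)
qed

lemma fps_split_at:
  fixes v :: "'a :: comm_ring_1 fps"
  shows "v = (\<Sum>i<n. fps_const (v $ i) * fps_X ^ i) + fps_X ^ n * fps_shift n v"
proof (rule fps_ext)
  fix m
  have "(\<Sum>i<n. fps_const (v $ i) * fps_X ^ i) $ m = (\<Sum>i<n. if m = i then v $ i else 0)"
    unfolding fps_sum_nth fps_mult_left_const_nth fps_X_power_nth by (intro sum.cong) auto
  also have "\<dots> = (if m < n then v $ m else 0)" by (simp add: sum.delta)
  finally show "v $ m = ((\<Sum>i<n. fps_const (v $ i) * fps_X ^ i) + fps_X ^ n * fps_shift n v) $ m"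
    unfolding fps_add_nth fps_X_power_mult_nth by auto
qed

text \<open>This expresses \<open>u\<close> as a combination of powers of \<open>t\<close> below the
  order of \<open>x\<close>, with coefficients \<open>U i\<close> in \<open>\<complex>{x}\<close>.
  The equality is kept in truncated form with an explicit multiple of \<open>x ^ k\<close>, which
  avoids composition of series.\<close>

lemma weierstrass_expansion:
  assumes x: "x \<in> conv1" "x \<noteq> 0" and u: "u \<in> conv1"
  obtains U q where "\<And>i. U i \<in> conv1"
    "\<And>k. u = (\<Sum>i<subdegree x. (\<Sum>m<k. fps_const (U i $ m) * x ^ m) * fps_X ^ i) + x ^ k * q k"
proof -
  define n where "n = subdegree x"
  define e where "e = inverse (fps_shift n x)"
  \<comment> \<open>\<open>x\<close> is \<open>fps_X ^ n\<close> times the inverse of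
    \<open>e\<close>, so \<open>D v\<close> is the quotient of \<open>v\<close> by \<open>x\<close>
    and the first \<open>n\<close> coefficients of \<open>v\<close> form the remainder. The
    \<open>k\<close>-th remainder supplies the \<open>k\<close>-th coefficients of the
    \<open>U i\<close>.\<close>
  define D where "D v = fps_shift n v * e" for v
  define q where "q k = (D ^^ k) u" for k
  define U where "U i = Abs_fps (\<lambda>k. q k $ i)" for i
  have nz: "fps_shift n x $ 0 \<noteq> 0" using x by (simp add: n_def)
  have "e \<in> conv1" unfolding e_def using x nz by (intro conv1_inverse) auto
  then obtain N S where S: "S > 0" and e: "\<And>m. norm (e $ m) \<le> N * S ^ m"
    unfolding conv1_iff_bound by blast
  obtain M R0 where R0: "R0 > 0" and M: "\<And>m. norm (u $ m) \<le> M * R0 ^ m"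
    using u unfolding conv1_iff_bound by blast
  have M0: "M \<ge> 0" using order.trans[OF norm_ge_zero M[of 0]] by simp
  have N0: "N \<ge> 0" using order.trans[OF norm_ge_zero e[of 0]] by simp
  define R where "R = max R0 (2 * S)"
  have R: "R > 0" "2 * S \<le> R" "R0 \<le> R" using R0 by (auto simp: R_def)
  define L where "L = 2 * N * R ^ n"
  have qb: "norm (q k $ m) \<le> (L ^ k * M) * R ^ m" for k m
  proof (induction k arbitrary: m)
    case 0
    have "M * R0 ^ m \<le> M * R ^ m" using M0 R R0 by (intro mult_left_mono power_mono) auto
    then show ?case using M[of m] by (simp add: q_def)
  next
    case (Suc k)
    show ?case using division_bound[OF Suc e R(2) S, of n m]
      by (simp add: q_def D_def L_def mult.assoc)
  qed
  have "U i \<in> conv1" for i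
  proof -
    \<comment> \<open>The base is \<open>L + 1\<close>, since only \<open>L \<ge> 0\<close> is at
      hand and \<open>conv1_iff_bound\<close> asks for a positive rate.\<close>
    have "norm (U i $ k) \<le> (M * R ^ i) * (L + 1) ^ k" for k
    proof -
      have "L ^ k \<le> (L + 1) ^ k" using N0 R by (intro power_mono) (auto simp: L_def)
      then have "(L ^ k * M) * R ^ i \<le> ((L + 1) ^ k * M) * R ^ i"
        using M0 R by (intro mult_right_mono) auto
      then show ?thesis using qb[of k i] by (simp add: U_def ac_simps)
    qed
    moreover have "L + 1 > 0" using N0 R by (simp add: L_def add_nonneg_pos)
    ultimately show ?thesis unfolding conv1_iff_bound by blast
  qed
  moreover have "u = (\<Sum>i<n. (\<Sum>m<k. fps_const (U i $ m) * x ^ m) * fps_X ^ i) + x ^ k * q k" for k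
  proof (induction k)
    case 0
    then show ?case by (simp add: q_def)
  next
    case (Suc k)
    have xD: "x * D v = fps_X ^ n * fps_shift n v" for v
    proof -
      have "x * D v = (fps_shift n x * fps_X ^ n) * D v"
        by (simp add: n_def flip: subdegree_decompose)
      also have "\<dots> = (inverse (fps_shift n x) * fps_shift n x) * (fps_X ^ n * fps_shift n v)"
        unfolding D_def e_def by (simp only: ac_simps)
      finally show ?thesis using nz by (simp add: inverse_mult_eq_1)
    qed
    have q: "q k = (\<Sum>i<n. fps_const (U i $ k) * fps_X ^ i) + x * q (Suc k)"
      using fps_split_at[of "q k" n] xD[of "q k"] by (simp add: q_def U_def)
    show ?case
      by (subst Suc, subst q)
         (simp add: algebra_simps sum.distrib sum_distrib_left)
  qed
  ultimately show thesis using that unfolding n_def by blast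
qed

text \<open>Describes the substitution of \<open>z\<close> into a one-variable series by its
  head-tail recursion and its homogeneity, so that \<open>X\<close> and \<open>Y\<close> are treated
  alike.\<close>

definition one_variable_section :: "conv2 \<Rightarrow> (complex fps \<Rightarrow> conv2) \<Rightarrow> bool" where
  "one_variable_section z s \<longleftrightarrow>
     (\<forall>G\<in>conv1. s G = const2 (G $ 0) + z * s (fps_shift 1 G)) \<and>
     (\<forall>c. \<forall>G\<in>conv1. s (fps_const c * G) = const2 c * s G)"

section \<open>The coordinates and the series in one of them\<close>

lift_definition coord_X :: conv2 is fps_X
  unfolding convergent2_iff_bound by (intro exI[of _ 1]) (auto simp: fps_X_def)

lift_definition coord_Y :: conv2 is "fps_const fps_X"
  unfolding convergent2_iff_bound by (intro exI[of _ 1]) (auto simp: fps_X_def)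

definition series_X :: "complex fps \<Rightarrow> conv2" where
  "series_X G = Abs_conv2 (Abs_fps (\<lambda>m. fps_const (G $ m)))"

definition series_Y :: "complex fps \<Rightarrow> conv2" where
  "series_Y G = Abs_conv2 (fps_const G)"

lemma Rep_series_X: "G \<in> conv1 \<Longrightarrow> Rep_conv2 (series_X G) = Abs_fps (\<lambda>m. fps_const (G $ m))"
proof -
  assume "G \<in> conv1"
  then obtain M R where R: "R > 0" and b: "\<And>m. norm (G $ m) \<le> M * R ^ m"
    unfolding conv1_iff_bound by blast
  have M: "M \<ge> 0" using order.trans[OF norm_ge_zero b[of 0]] by simp
  have "norm (Abs_fps (\<lambda>m. fps_const (G $ m)) $ m $ n) \<le> M * R ^ (m + n)" for m n
    using b[of m] R M by (cases n) auto
  then have "convergent2 (Abs_fps (\<lambda>m. fps_const (G $ m)))"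
    unfolding convergent2_iff_bound using R by blast
  then show ?thesis unfolding series_X_def by (intro Abs_conv2_inverse) simp
qed

lemma Rep_series_Y: "G \<in> conv1 \<Longrightarrow> Rep_conv2 (series_Y G) = fps_const G"
proof -
  assume "G \<in> conv1"
  then obtain M R where R: "R > 0" and b: "\<And>m. norm (G $ m) \<le> M * R ^ m"
    unfolding conv1_iff_bound by blast
  have M: "M \<ge> 0" using order.trans[OF norm_ge_zero b[of 0]] by simp
  have "norm (fps_const G $ m $ n) \<le> M * R ^ (m + n)" for m n
    using b[of n] R M by (cases m) auto
  then have "convergent2 (fps_const G)"
    unfolding convergent2_iff_bound using R by blast
  then show ?thesis unfolding series_Y_def by (intro Abs_conv2_inverse) simp
qed

lemma conv1_cmult: "G \<in> conv1 \<Longrightarrow> fps_const c * G \<in> conv1"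
  by (rule conv1_mult) (simp_all add: conv1_def)

lemma fps_split_head: "G = fps_const (G $ 0) + fps_X * fps_shift 1 G" for G :: "'a :: comm_ring_1 fps"
  using fps_split_at[of G 1] by simp

lemma series_X_section: "one_variable_section coord_X series_X"
  unfolding one_variable_section_def
proof (intro conjI ballI allI)
  fix G c assume G: "G \<in> conv1"
  show "series_X G = const2 (G $ 0) + coord_X * series_X (fps_shift 1 G)"
    unfolding Rep_conv2_inject[symmetric] plus_conv2.rep_eq times_conv2.rep_eq const2.rep_eq coord_X.rep_eq
    using G by (subst (1 2) Rep_series_X) (auto simp: fps_eq_iff[of "Abs_fps _"] fps_X_mult_nth)
  show "series_X (fps_const c * G) = const2 c * series_X G"
    unfolding Rep_conv2_inject[symmetric] times_conv2.rep_eq const2.rep_eq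
    using G conv1_cmult by (subst (1 2) Rep_series_X) (auto simp: fps_eq_iff[of "Abs_fps _"])
qed

lemma series_Y_section: "one_variable_section coord_Y series_Y"
  unfolding one_variable_section_def
proof (intro conjI ballI allI)
  fix G c assume G: "G \<in> conv1"
  show "series_Y G = const2 (G $ 0) + coord_Y * series_Y (fps_shift 1 G)"
    unfolding Rep_conv2_inject[symmetric] plus_conv2.rep_eq times_conv2.rep_eq const2.rep_eq coord_Y.rep_eq
    using G fps_split_head[of G] by (subst (1 2) Rep_series_Y) auto
  show "series_Y (fps_const c * G) = const2 c * series_Y G"
    unfolding Rep_conv2_inject[symmetric] times_conv2.rep_eq const2.rep_eq
    using G conv1_cmult by (subst (1 2) Rep_series_Y) auto
qed

text \<open>The splitting \<open>a(X,Y) = a(0,Y) + X b\<close>. With the recursion for series in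
  \<open>Y\<close> it reduces constant terms under a homomorphism to the images of the two
  coordinates.\<close>

lemma conv2_decompose:
  obtains b where "Rep_conv2 a $ 0 \<in> conv1" "a = series_Y (Rep_conv2 a $ 0) + coord_X * b"
proof -
  let ?A = "Rep_conv2 a"
  obtain M R where R: "R > 0" and b: "\<And>m n. norm (?A $ m $ n) \<le> M * R ^ (m + n)"
    using Rep_conv2[of a] unfolding mem_Collect_eq convergent2_iff_bound by blast
  have 0: "?A $ 0 \<in> conv1" unfolding conv1_iff_bound using R b[of 0] by auto
  have "norm (fps_shift 1 ?A $ m $ n) \<le> (M * R) * R ^ (m + n)" for m n
    using b[of "m + 1" n] by (simp add: ac_simps)
  then have "convergent2 (fps_shift 1 ?A)" unfolding convergent2_iff_bound using R by blast
  then have "Rep_conv2 (Abs_conv2 (fps_shift 1 ?A)) = fps_shift 1 ?A"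
    by (intro Abs_conv2_inverse) simp
  then have "a = series_Y (?A $ 0) + coord_X * Abs_conv2 (fps_shift 1 ?A)"
    unfolding Rep_conv2_inject[symmetric] plus_conv2.rep_eq times_conv2.rep_eq coord_X.rep_eq
    using Rep_series_Y[OF 0] fps_split_head[of ?A] by simp
  with 0 show thesis by (rule that)
qed

text \<open>In characteristic 0, differentiation lowers a positive order by exactly one, whereas
  multiples of \<open>a\<close> have at least the order of \<open>a\<close>. The coefficients may
  themselves be power series.\<close>

lemma fps_not_dvd_deriv:
  fixes a :: "'a :: {idom, semiring_char_0} fps"
  assumes "a \<noteq> 0" "a $ 0 = 0"
  shows "\<not> a dvd fps_deriv a"
proof
  assume "a dvd fps_deriv a"
  then obtain b where b: "fps_deriv a = a * b" ..
  obtain p where p: "subdegree a = Suc p"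
    using assms by (cases "subdegree a") (auto simp: subdegree_eq_0_iff)
  have "(a * b) $ p = 0"
    unfolding fps_mult_nth by (intro sum.neutral) (auto simp: p nth_less_subdegree_zero)
  then have "of_nat (Suc p) * a $ Suc p = 0" by (simp flip: b)
  then have "a $ Suc p = 0" by (simp del: of_nat_Suc)
  then show False using assms(1) p nth_subdegree_nonzero by metis
qed

text \<open>If \<open>a(0,Y)\<close> vanishes, orders in \<open>X\<close> are compared; otherwise
  set \<open>X = 0\<close> and compare orders in \<open>Y\<close>.\<close>

lemma conv2_not_dvd_derivs:
  assumes "a \<noteq> 0" "Rep_conv2 a $ 0 $ 0 = 0"
  shows "\<not> (a dvd deriv_X a \<and> a dvd deriv_Y a)"
proof (cases "Rep_conv2 a $ 0 = 0")
  case True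
  have "Rep_conv2 a \<noteq> 0" using assms(1) by (metis Rep_conv2_inject zero_conv2.rep_eq)
  then have "\<not> Rep_conv2 a dvd fps_deriv (Rep_conv2 a)" using True by (rule fps_not_dvd_deriv)
  then have "\<not> a dvd deriv_X a"
    by (metis deriv_X.rep_eq dvd_def times_conv2.rep_eq)
  then show ?thesis by blast
next
  case False
  then have n: "\<not> Rep_conv2 a $ 0 dvd fps_deriv (Rep_conv2 a $ 0)"
    using assms(2) by (rule fps_not_dvd_deriv)
  have "\<not> a dvd deriv_Y a"
  proof
    assume "a dvd deriv_Y a"
    then obtain b where "deriv_Y a = a * b" ..
    then have "Rep_conv2 (deriv_Y a) $ 0 = Rep_conv2 a $ 0 * Rep_conv2 b $ 0"
      by (simp add: times_conv2.rep_eq)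
    then show False using n by (simp add: deriv_Y.rep_eq)
  qed
  then show ?thesis by blast
qed

section \<open>The conductor of a branch\<close>

lemma section_step:
  "one_variable_section z s \<Longrightarrow> G \<in> conv1 \<Longrightarrow> s G = const2 (G $ 0) + z * s (fps_shift 1 G)"
  unfolding one_variable_section_def by blast

lemma section_smult:
  "one_variable_section z s \<Longrightarrow> G \<in> conv1 \<Longrightarrow> s (fps_const c * G) = const2 c * s G"
  unfolding one_variable_section_def by blast

text \<open>A Taylor formula with algebraic remainder: a homomorphism can be applied to it without
  any continuity.\<close>

lemma section_expansion:
  assumes s: "one_variable_section z s" and G: "G \<in> conv1"
  shows "s G = (\<Sum>m<k. const2 (G $ m) * z ^ m) + z ^ k * s (fps_shift k G)"
proof (induction k)
  case (Suc k)
  have "s (fps_shift k G) = const2 (fps_shift k G $ 0) + z * s (fps_shift 1 (fps_shift k G))"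
    by (rule section_step[OF s]) (simp add: G)
  moreover have "fps_shift 1 (fps_shift k G) = fps_shift (Suc k) G" by (simp add: fps_eq_iff)
  ultimately have "s (fps_shift k G) = const2 (G $ k) + z * s (fps_shift (Suc k) G)"
    by simp
  with Suc show ?case by (simp add: algebra_simps)
qed simp

locale branch_hom =
  fixes \<phi> :: "conv2 \<Rightarrow> complex fps"
  assumes add: "\<phi> (a + b) = \<phi> a + \<phi> b"
    and mult: "\<phi> (a * b) = \<phi> a * \<phi> b"
    and const: "\<phi> (const2 c) = fps_const c"
    and conv: "\<phi> a \<in> conv1"
begin

lemma zero: "\<phi> 0 = 0" and one: "\<phi> 1 = 1"
  using const[of 0] const[of 1] by simp_all

lemma uminus: "\<phi> (- a) = - \<phi> a"
  using add[of "- a" a] zero by (simp add: eq_neg_iff_add_eq_0)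

lemma diff: "\<phi> (a - b) = \<phi> a - \<phi> b"
  using add[of a "- b"] uminus by simp

lemma sum: "\<phi> (sum g A) = (\<Sum>x\<in>A. \<phi> (g x))"
  by (induction A rule: infinite_finite_induct) (simp_all add: zero add)

lemma power: "\<phi> (a ^ n) = \<phi> a ^ n"
  by (induction n) (simp_all add: one mult)

text \<open>Otherwise \<open>z\<close> minus a nonzero constant, a unit given by a geometric series, would map to a nonunit.\<close>

lemma section_local:
  assumes s: "one_variable_section z s"
  shows "\<phi> z $ 0 = 0"
proof (rule ccontr)
  assume c: "\<phi> z $ 0 \<noteq> 0"
  define c where "c = \<phi> z $ 0"
  \<comment> \<open>\<open>G\<close> is the series of \<open>1 / (c - T)\<close>, so
    \<open>s G\<close> plays the inverse of \<open>c - z\<close>. At \<open>t = 0\<close> the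
    recursion says that a number equals itself plus \<open>1 / c\<close>.\<close>
  define G where "G = Abs_fps (\<lambda>m. inverse c ^ (m + 1))"
  have "norm (G $ m) \<le> norm (inverse c) * norm (inverse c) ^ m" for m
    by (simp add: G_def norm_mult norm_power)
  then have G: "G \<in> conv1"
    unfolding conv1_iff_bound using c by (intro exI[of _ "norm (inverse c)"] conjI) (auto simp: c_def)
  have "fps_shift 1 G = fps_const (inverse c) * G" by (simp add: G_def fps_eq_iff)
  then have "s (fps_shift 1 G) = const2 (inverse c) * s G"
    by (simp only: section_smult[OF s G])
  then have "s G = const2 (inverse c) + z * (const2 (inverse c) * s G)"
    using section_step[OF s G] by (simp add: G_def)
  then have "\<phi> (s G) = fps_const (inverse c) + \<phi> z * (fps_const (inverse c) * \<phi> (s G))"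
    by (metis add mult const)
  then have "\<phi> (s G) $ 0 = (fps_const (inverse c) + \<phi> z * (fps_const (inverse c) * \<phi> (s G))) $ 0"
    by (rule arg_cong)
  then show False using c by (simp add: c_def flip: mult.assoc)
qed

text \<open>Both coordinates map to nonunits by \<open>section_local\<close>, so only the constant
  of \<open>a\<close> contributes at \<open>t = 0\<close>.\<close>

lemma const_term: "\<phi> a $ 0 = Rep_conv2 a $ 0 $ 0"
proof -
  obtain b where G: "Rep_conv2 a $ 0 \<in> conv1" and a: "a = series_Y (Rep_conv2 a $ 0) + coord_X * b"
    by (rule conv2_decompose)
  have "series_Y (Rep_conv2 a $ 0) = const2 (Rep_conv2 a $ 0 $ 0)
      + coord_Y * series_Y (fps_shift 1 (Rep_conv2 a $ 0))"
    by (rule section_step[OF series_Y_section G])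
  with a have "a = const2 (Rep_conv2 a $ 0 $ 0)
      + coord_Y * series_Y (fps_shift 1 (Rep_conv2 a $ 0)) + coord_X * b"
    by metis
  then have "\<phi> a = fps_const (Rep_conv2 a $ 0 $ 0)
      + \<phi> coord_Y * \<phi> (series_Y (fps_shift 1 (Rep_conv2 a $ 0))) + \<phi> coord_X * \<phi> b"
    by (metis add mult const)
  then have "\<phi> a $ 0 = (fps_const (Rep_conv2 a $ 0 $ 0)
      + \<phi> coord_Y * \<phi> (series_Y (fps_shift 1 (Rep_conv2 a $ 0))) + \<phi> coord_X * \<phi> b) $ 0"
    by (rule arg_cong)
  then show ?thesis
    by (simp add: section_local[OF series_X_section] section_local[OF series_Y_section])
qed

text \<open>
  If \<open>x = \<phi> z\<close> has order \<open>n\<close>, then \<open>1, t, ..., t\<^sup>n\<^sup>-\<^sup>1\<close> generate \<open>\<complex>{t}\<close> over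
  \<open>\<complex>{x}\<close>, and a power of the denominator of \<open>t\<close> clears the denominators of all of them.
\<close>

lemma section_conductor:
  assumes s: "one_variable_section z s" and z: "\<phi> z \<noteq> 0"
    and b: "\<phi> b \<noteq> 0" "fps_X * \<phi> b = \<phi> a" and u: "u \<in> conv1"
  shows "\<phi> b ^ subdegree (\<phi> z) * u \<in> range \<phi>"
proof -
  define x where "x = \<phi> z"
  define n where "n = subdegree x"
  have n0: "n > 0" using z section_local[OF s] by (simp add: n_def x_def subdegree_eq_0_iff neq0_conv[symmetric])
  obtain U q where U: "\<And>i. U i \<in> conv1"
    and q: "\<And>k. u = (\<Sum>i<n. (\<Sum>m<k. fps_const (U i $ m) * x ^ m) * fps_X ^ i) + x ^ k * q k"
    by (rule weierstrass_expansion[OF conv[of z] z u, folded x_def, folded n_def]) (rule that)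
  \<comment> \<open>These images have the same truncations as the coefficients in the expansion of
    \<open>u\<close>; hence the difference \<open>d\<close> is divisible by every power of
    \<open>x\<close>.\<close>
  have exp: "\<phi> (s (U i)) = (\<Sum>m<k. fps_const (U i $ m) * x ^ m) + x ^ k * \<phi> (s (fps_shift k (U i)))" for i k
    by (subst section_expansion[OF s U, of _ k])
       (simp add: add mult sum power const x_def)
  define d where "d = u - (\<Sum>i<n. \<phi> (s (U i)) * fps_X ^ i)"
  have "x ^ k dvd d" for k
  proof -
    have "(\<Sum>i<n. \<phi> (s (U i)) * fps_X ^ i)
        = (\<Sum>i<n. (\<Sum>m<k. fps_const (U i $ m) * x ^ m) * fps_X ^ i)
          + x ^ k * (\<Sum>i<n. \<phi> (s (fps_shift k (U i))) * fps_X ^ i)"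
      unfolding exp[of _ k] by (simp add: distrib_right sum.distrib sum_distrib_left mult.assoc)
    then have "d = x ^ k * (q k - (\<Sum>i<n. \<phi> (s (fps_shift k (U i))) * fps_X ^ i))"
      unfolding d_def by (subst q[of k]) (simp add: right_diff_distrib)
    then show ?thesis by simp
  qed
  note x_dvd = this
  have "d = 0"
  proof (rule ccontr)
    assume d: "d \<noteq> 0"
    \<comment> \<open>Since \<open>x\<close> has positive order, this power has order above that of
      \<open>d\<close>, which is absurd.\<close>
    obtain w where w: "d = x ^ (subdegree d + 1) * w" using x_dvd by blast
    then have "w \<noteq> 0" "x \<noteq> 0" using d z by (auto simp: x_def)
    then have "subdegree d = (subdegree d + 1) * n + subdegree w"
      by (subst (1) w) (simp add: n_def)
    moreover have "(subdegree d + 1) * n \<ge> (subdegree d + 1) * 1" using n0 by (intro mult_left_mono) auto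
    ultimately show False by simp
  qed
  then have u_eq: "u = (\<Sum>i<n. \<phi> (s (U i)) * fps_X ^ i)" by (simp add: d_def)
  \<comment> \<open>As \<open>fps_X * \<phi> b = \<phi> a\<close>, the factor
    \<open>\<phi> b ^ i\<close> absorbs \<open>fps_X ^ i\<close>, and \<open>i < n\<close> leaves a
    nonnegative power of \<open>\<phi> b\<close>.\<close>
  have "\<phi> b ^ n * u = (\<Sum>i<n. \<phi> (s (U i)) * \<phi> b ^ (n - i) * (fps_X * \<phi> b) ^ i)"
    unfolding u_eq sum_distrib_left
  proof (rule sum.cong)
    fix i assume "i \<in> {..<n}"
    then have "\<phi> b ^ n = \<phi> b ^ (n - i) * \<phi> b ^ i" by (simp flip: power_add)
    then show "\<phi> b ^ n * (\<phi> (s (U i)) * fps_X ^ i)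
        = \<phi> (s (U i)) * \<phi> b ^ (n - i) * (fps_X * \<phi> b) ^ i"
      by (simp add: power_mult_distrib ac_simps)
  qed simp
  also have "\<dots> = \<phi> (\<Sum>i<n. s (U i) * b ^ (n - i) * a ^ i)"
    by (simp add: sum mult power b)
  finally show ?thesis by (simp add: n_def x_def)
qed

end

lemma normalization_branch_hom: "normalization h \<phi> \<Longrightarrow> branch_hom \<phi>"
  unfolding normalization_def branch_hom_def by blast

lemma normalization_kernel: "normalization h \<phi> \<Longrightarrow> \<phi> a = 0 \<longleftrightarrow> h dvd a"
  unfolding normalization_def in_ideal_gen_1 by blast

lemma normalization_conductor:
  assumes "normalization h \<phi>"
  obtains d where "d \<noteq> 0" "d \<in> conv1" "\<And>u. u \<in> conv1 \<Longrightarrow> d * u \<in> range \<phi>"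
proof -
  interpret branch_hom \<phi> using assms by (rule normalization_branch_hom)
  obtain a b where b: "\<phi> b \<noteq> 0" "fps_X * \<phi> b = \<phi> a"
    using assms fps_X_in_conv1 unfolding normalization_def by blast
  \<comment> \<open>If both coordinates mapped to 0, the image of \<open>\<phi>\<close> would
    consist of constants, and \<open>t\<close> could not be a quotient of two of them.\<close>
  have "\<phi> coord_X \<noteq> 0 \<or> \<phi> coord_Y \<noteq> 0"
  proof (rule ccontr)
    assume z: "\<not> (\<phi> coord_X \<noteq> 0 \<or> \<phi> coord_Y \<noteq> 0)"
    have c: "\<phi> v = fps_const (Rep_conv2 v $ 0 $ 0)" for v
    proof -
      obtain w where G: "Rep_conv2 v $ 0 \<in> conv1" and v: "v = series_Y (Rep_conv2 v $ 0) + coord_X * w"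
        by (rule conv2_decompose)
      have "series_Y (Rep_conv2 v $ 0) = const2 (Rep_conv2 v $ 0 $ 0)
          + coord_Y * series_Y (fps_shift 1 (Rep_conv2 v $ 0))"
        by (rule section_step[OF series_Y_section G])
      then have "\<phi> (series_Y (Rep_conv2 v $ 0)) = fps_const (Rep_conv2 v $ 0 $ 0)"
        using z by (metis add mult const mult_zero_left add.right_neutral)
      moreover have "\<phi> v = \<phi> (series_Y (Rep_conv2 v $ 0))"
        using v z by (metis add mult mult_zero_left add.right_neutral)
      ultimately show ?thesis by simp
    qed
    have "(fps_X * \<phi> b) $ 1 = 0" unfolding b(2) c[of a] by simp
    then show False using b(1) c[of b] by simp
  qed
  then obtain z s where "one_variable_section z s" "\<phi> z \<noteq> 0"
    using series_X_section series_Y_section by blast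
  then have "\<phi> b ^ subdegree (\<phi> z) * u \<in> range \<phi>" if "u \<in> conv1" for u
    using section_conductor b that by blast
  moreover have "\<phi> b ^ subdegree (\<phi> z) \<noteq> 0" using b by simp
  moreover have "\<phi> b ^ subdegree (\<phi> z) \<in> conv1" using conv power by metis
  ultimately show thesis using that by blast
qed

text \<open>The multiples of \<open>h\<close> are the kernel of a homomorphism into an integral
  domain.\<close>

lemma normalization_prime_elem:
  assumes "normalization h \<phi>" "irreducible h"
  shows "prime_elem h"
proof -
  interpret branch_hom \<phi> using assms(1) by (rule normalization_branch_hom)
  have "h dvd a \<or> h dvd b" if "h dvd a * b" for a b
    using that by (simp add: normalization_kernel[OF assms(1), symmetric] mult)
  then show ?thesis using assms(2) by (auto simp: prime_elem_def irreducible_def)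
qed

lemma normalization_not_dvd_derivs:
  assumes "normalization h \<phi>" "h \<noteq> 0"
  shows "\<not> (h dvd deriv_X h \<and> h dvd deriv_Y h)"
proof -
  interpret branch_hom \<phi> using assms(1) by (rule normalization_branch_hom)
  have "\<phi> h = 0" by (simp add: normalization_kernel[OF assms(1)])
  then show ?thesis using const_term[of h] assms(2) by (intro conv2_not_dvd_derivs) auto
qed

section \<open>Counting orders\<close>

lemma fps_order_iff:
  "u \<noteq> 0 \<and> subdegree u = n \<longleftrightarrow> u $ n \<noteq> 0 \<and> (\<forall>m<n. u $ m = 0)" for u :: "'a :: zero fps"
proof
  assume "u \<noteq> 0 \<and> subdegree u = n"
  then show "u $ n \<noteq> 0 \<and> (\<forall>m<n. u $ m = 0)" using nth_subdegree_nonzero by blast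
next
  assume "u $ n \<noteq> 0 \<and> (\<forall>m<n. u $ m = 0)"
  then show "u \<noteq> 0 \<and> subdegree u = n" by (metis fps_zero_nth subdegreeI)
qed

lemma t_order_fps: "t_order (fps_to_fls u) = (if u = 0 then Pinf else Fin (int (subdegree u)))"
  by (simp add: t_order_def fls_subdegree_fls_to_fps)

text \<open>Filter \<open>P\<close> by \<open>V n = F n + Q\<close>. A step of this filtration has
  dimension 1 if \<open>n\<close> is an order on \<open>P\<close> but not on \<open>Q\<close>, and 0
  otherwise. The filtration starts at \<open>P\<close> and reaches \<open>K + Q\<close> at the index
  \<open>c\<close>.\<close>

lemma reldim_eq_ecard_orders:
  assumes norm: "normalization h \<phi>" and P: "conv2.subspace P" and Q: "conv2_ideal.subspace Q"
    and QP: "Q \<subseteq> P" and q0: "q0 \<in> Q" "\<phi> q0 \<noteq> 0"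
  defines "ord \<equiv> \<lambda>S. (\<lambda>x. t_order (fps_to_fls (\<phi> x))) ` S"
  shows "conv2.reldim P ({x \<in> P. \<phi> x = 0} + Q) = ecard (ord P - ord Q)"
proof -
  interpret branch_hom \<phi> using norm by (rule normalization_branch_hom)
  define K where "K = {x \<in> P. \<phi> x = 0}"
  define F where "F n = {x \<in> P. \<forall>m<n. \<phi> x $ m = 0}" for n
  define V where "V n = F n + Q" for n
  define \<nu> where "\<nu> S = {n. \<exists>x\<in>S. \<phi> x $ n \<noteq> 0 \<and> (\<forall>m<n. \<phi> x $ m = 0)}" for S
  have Qs: "conv2.subspace Q" using Q by (rule subspace_if_ideal)
  have P_add: "x + y \<in> P" and P_diff: "x - y \<in> P" and P_scale: "const2 c * x \<in> P"
    if "x \<in> P" "y \<in> P" for x y c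
    using P that conv2.subspace_add conv2.subspace_diff conv2.subspace_scale by blast+
  have Q_add: "x + y \<in> Q" and Q_scale: "const2 c * x \<in> Q" if "x \<in> Q" "y \<in> Q" for x y c
    using Qs that conv2.subspace_add conv2.subspace_scale by blast+
  have P0: "0 \<in> P" and Q0: "0 \<in> Q" using P Qs conv2.subspace_0 by auto
  have F: "conv2.subspace (F n)" for n
    unfolding F_def using P0 P_add P_scale
    by (intro conv2.subspaceI) (auto simp: zero add mult const)
  have V: "conv2.subspace (V n)" for n unfolding V_def using F Qs by (rule set_plus_subspace)
  have VI: "y + q \<in> V n" if "y \<in> F n" "q \<in> Q" for y q n
    unfolding V_def using that by (rule set_plus_intro)
  have F_Suc: "y - const2 (\<phi> y $ n / \<phi> x $ n) * x \<in> F (Suc n)"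
    if "y \<in> F n" "x \<in> F n" "\<phi> x $ n \<noteq> 0" for x y n
    using that P_diff P_scale by (auto simp: F_def diff mult const less_Suc_eq)
  have V_Suc: "V (Suc n) \<subseteq> V n" for n
    unfolding V_def by (rule set_plus_mono2) (auto simp: F_def)
  have V0: "V 0 = P"
  proof
    show "V 0 \<subseteq> P" using QP P_add by (auto simp: V_def F_def elim!: set_plus_elim)
    show "P \<subseteq> V 0" using VI[of _ 0 0] Q0 by (auto simp: F_def)
  qed
  obtain d where d: "d \<noteq> 0" "d \<in> conv1" and dr: "\<And>u. u \<in> conv1 \<Longrightarrow> d * u \<in> range \<phi>"
    using normalization_conductor[OF norm] by metis
  \<comment> \<open>From order \<open>c\<close> on, every \<open>\<phi> x\<close> is a multiple
    \<open>(d * \<phi> q0) * u\<close>. The conductor \<open>d\<close> puts \<open>d * u\<close> in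
    the range of \<open>\<phi>\<close>, and the ideal property of \<open>Q\<close> then gives a
    preimage in \<open>Q\<close>.\<close>
  define c where "c = subdegree (d * \<phi> q0)"
  have high: "\<exists>q\<in>Q. \<phi> q = \<phi> x" if x: "x \<in> F c" for x
  proof (cases "\<phi> x = 0")
    case True
    then show ?thesis using Q0 zero by auto
  next
    case False
    then have "c \<le> subdegree (\<phi> x)" using x by (intro subdegree_geI) (auto simp: F_def)
    then obtain u where u: "u \<in> conv1" "\<phi> x = (d * \<phi> q0) * u"
      using conv1_quotient[of "d * \<phi> q0" "\<phi> x"] d q0 conv conv1_mult
      by (metis c_def mult_eq_0_iff)
    obtain y where "d * u = \<phi> y" using dr u by blast
    then have "\<phi> (y * q0) = \<phi> x" using u by (simp add: mult ac_simps)
    moreover have "y * q0 \<in> Q" using Q q0 conv2_ideal.subspace_scale by blast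
    ultimately show ?thesis by blast
  qed
  have Vc: "V c = K + Q"
  proof
    show "V c \<subseteq> K + Q"
    proof
      fix z assume "z \<in> V c"
      then obtain x q where xq: "x \<in> F c" "q \<in> Q" "z = x + q"
        unfolding V_def by (rule set_plus_elim)
      obtain q' where q': "q' \<in> Q" "\<phi> q' = \<phi> x" using high xq by blast
      have "x - q' \<in> K" using q' xq QP P_diff by (auto simp: K_def F_def diff)
      moreover have "q' + q \<in> Q" using q' xq Q_add by blast
      ultimately have "(x - q') + (q' + q) \<in> K + Q" by (rule set_plus_intro)
      then show "z \<in> K + Q" using xq by simp
    qed
    show "K + Q \<subseteq> V c" unfolding V_def by (rule set_plus_mono2) (auto simp: F_def K_def)
  qed
  have step: "conv2.reldim (V n) (V (Suc n)) = (if n \<in> \<nu> P - \<nu> Q then 1 else 0)" for n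
  proof (cases "n \<in> \<nu> P - \<nu> Q")
    case True
    then obtain x where x: "x \<in> F n" "\<phi> x $ n \<noteq> 0" by (auto simp: \<nu>_def F_def)
    have "conv2.reldim (V n) (V (Suc n)) = 1"
    proof (rule conv2.reldim_singleton[OF V V])
      show "x \<in> V n" using VI[OF x(1) Q0] by simp
      show "x \<notin> V (Suc n)"
      proof
        assume "x \<in> V (Suc n)"
        then obtain y q where yq: "y \<in> F (Suc n)" "q \<in> Q" "x = y + q"
          unfolding V_def by (rule set_plus_elim)
        then have "\<phi> q = \<phi> x - \<phi> y" by (simp add: add)
        then have "\<phi> q $ n \<noteq> 0 \<and> (\<forall>m<n. \<phi> q $ m = 0)" using x yq(1) by (auto simp: F_def)
        then show False using True yq(2) by (auto simp: \<nu>_def)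
      qed
      show "\<exists>c. u - const2 c * x \<in> V (Suc n)" if u: "u \<in> V n" for u
      proof -
        obtain y q where yq: "y \<in> F n" "q \<in> Q" "u = y + q"
          using u unfolding V_def by (rule set_plus_elim)
        have "(y - const2 (\<phi> y $ n / \<phi> x $ n) * x) + q \<in> V (Suc n)"
          using F_Suc x yq by (intro VI) auto
        then show ?thesis using yq(3) by (intro exI[of _ "\<phi> y $ n / \<phi> x $ n"]) (simp add: algebra_simps)
      qed
    qed
    then show ?thesis using True by simp
  next
    case False
    \<comment> \<open>A nonzero coefficient at \<open>n\<close> makes \<open>n\<close> an order on
      \<open>P\<close>, hence on \<open>Q\<close>, and an element of \<open>Q\<close> of that order
      cancels it.\<close>
    have "V n \<subseteq> V (Suc n)"
    proof
      fix u assume "u \<in> V n"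
      then obtain y q where yq: "y \<in> F n" "q \<in> Q" "u = y + q"
        unfolding V_def by (rule set_plus_elim)
      show "u \<in> V (Suc n)"
      proof (cases "\<phi> y $ n = 0")
        case True
        then have "y \<in> F (Suc n)" using yq(1) by (auto simp: F_def less_Suc_eq)
        then show ?thesis using yq VI by blast
      next
        case nz: False
        then have "n \<in> \<nu> P" using yq(1) by (auto simp: \<nu>_def F_def)
        then obtain q' where q': "q' \<in> Q" "\<phi> q' $ n \<noteq> 0" "\<forall>m<n. \<phi> q' $ m = 0"
          using False by (auto simp: \<nu>_def)
        then have "q' \<in> F n" using QP by (auto simp: F_def)
        let ?c = "\<phi> y $ n / \<phi> q' $ n"
        have "(y - const2 ?c * q') + (const2 ?c * q' + q) \<in> V (Suc n)"
          using F_Suc \<open>q' \<in> F n\<close> q' yq Q_add Q_scale by (intro VI) auto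
        then show ?thesis using yq(3) by simp
      qed
    qed
    then have "V n = V (Suc n)" using V_Suc by blast
    then show ?thesis using False conv2.reldim_self[OF V] by simp
  qed
  have bounded: "\<nu> P - \<nu> Q \<subseteq> {0..<c}"
  proof
    fix n assume n: "n \<in> \<nu> P - \<nu> Q"
    then obtain x where x: "x \<in> P" "\<phi> x $ n \<noteq> 0" "\<forall>m<n. \<phi> x $ m = 0" by (auto simp: \<nu>_def)
    have "\<not> c \<le> n"
    proof
      assume "c \<le> n"
      then have "x \<in> F c" using x by (auto simp: F_def)
      then obtain q where "q \<in> Q" "\<phi> q = \<phi> x" using high by blast
      then have "n \<in> \<nu> Q" using x unfolding \<nu>_def by (intro CollectI bexI[of _ q]) auto
      then show False using n by blast
    qed
    then show "n \<in> {0..<c}" by simp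
  qed
  have "conv2.reldim P (K + Q) = (\<Sum>n=0..<c. if n \<in> \<nu> P - \<nu> Q then 1 else 0)"
    using conv2.reldim_chain[of V 0 c, OF V V_Suc] by (simp only: V0 Vc step)
  also have "\<dots> = (\<Sum>n\<in>\<nu> P - \<nu> Q. 1)"
    by (rule sum.mono_neutral_cong_right) (use bounded in auto)
  also have "\<dots> = ecard (\<nu> P - \<nu> Q)"
    using finite_subset[OF bounded] by (simp add: ecard_def of_nat_eq_enat)
  also have "\<dots> = ecard ((\<lambda>n. Fin (int n)) ` (\<nu> P - \<nu> Q))"
    by (rule ecard_image[symmetric]) (simp add: inj_on_def)
  also have "(\<lambda>n. Fin (int n)) ` (\<nu> P - \<nu> Q) = ord P - ord Q"
  proof -
    \<comment> \<open>The value \<open>Pinf\<close> comes from 0, which lies in both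
      \<open>P\<close> and \<open>Q\<close>, so it drops out of the difference.\<close>
    have o: "ord S = insert Pinf ((\<lambda>n. Fin (int n)) ` \<nu> S)" if "0 \<in> S" for S
    proof -
      have \<nu>: "\<nu> S = {n. \<exists>x\<in>S. \<phi> x \<noteq> 0 \<and> subdegree (\<phi> x) = n}"
        unfolding \<nu>_def fps_order_iff ..
      show ?thesis unfolding \<nu> ord_def t_order_fps using that zero by (auto simp: image_iff)
    qed
    show ?thesis unfolding o[OF P0] o[OF Q0] by (auto simp: image_iff)
  qed
  finally show ?thesis by (simp add: K_def)
qed

section \<open>Orders on the Jacobian ideal and the final count\<close>

lemma irreducible_dvd_ideal_gen_eq:
  assumes "irreducible a" "irreducible b" "a dvd b"
  shows "ideal_gen {a} = ideal_gen {b}"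
proof -
  obtain c where c: "b = a * c" using assms(3) ..
  then have "c dvd 1" using assms irreducibleD[of b a c] by (auto simp: irreducible_def)
  then have "b dvd a" using c by (auto simp: mult_unit_dvd_iff)
  then show ?thesis using assms(3) by (auto simp: in_ideal_gen_1 intro: dvd_trans)
qed

text \<open>\<open>F\<close> vanishes on every branch, so the Tjurina ideal and the Jacobian
  combinations have the same images there. This moves the count from families of Laurent series to
  ideals of \<open>conv2\<close>.\<close>

lemma order_set_vanishing_part:
  assumes hom: "\<And>i. i \<in> I \<Longrightarrow> branch_hom (\<phi> i)" and F: "\<And>i. i \<in> I \<Longrightarrow> \<phi> i F = 0"
    and "L \<subseteq> I" "k \<in> I"
  shows "order_set k (vanishing_part (jacobian_ideal I \<phi> F) L)
    = (\<lambda>x. t_order (fps_to_fls (\<phi> k x))) ` {x \<in> tjurina_ideal F. \<forall>l\<in>L. \<phi> l x = 0}"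
proof -
  define J where "J a b = a * deriv_X F + b * deriv_Y F" for a b
  have J: "(\<lambda>i\<in>I. germ I \<phi> a i * germ I \<phi> (deriv_X F) i + germ I \<phi> b i * germ I \<phi> (deriv_Y F) i)
      = (\<lambda>i\<in>I. fps_to_fls (\<phi> i (J a b)))" for a b
  proof (rule ext)
    fix i
    show "(\<lambda>i\<in>I. germ I \<phi> a i * germ I \<phi> (deriv_X F) i + germ I \<phi> b i * germ I \<phi> (deriv_Y F) i) i
      = (\<lambda>i\<in>I. fps_to_fls (\<phi> i (J a b))) i"
      using branch_hom.add[OF hom] branch_hom.mult[OF hom]
      by (simp add: germ_def J_def fls_times_fps_to_fls)
  qed
  have jac: "jacobian_ideal I \<phi> F = {(\<lambda>i\<in>I. fps_to_fls (\<phi> i (J a b))) | a b. True}"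
    unfolding jacobian_ideal_def local_ring_def J[symmetric] by blast
  have T: "\<exists>a b. \<forall>i\<in>I. \<phi> i x = \<phi> i (J a b)" if x: "x \<in> tjurina_ideal F" for x
  proof -
    obtain u v w where "x = u * F + v * deriv_X F + w * deriv_Y F"
      using x unfolding in_tjurina_ideal by blast
    then have "x = u * F + J v w" by (simp add: J_def add.assoc)
    then have "\<forall>i\<in>I. \<phi> i x = \<phi> i (J v w)"
      using branch_hom.add[OF hom] branch_hom.mult[OF hom] F by simp
    then show ?thesis by blast
  qed
  have JT: "J a b \<in> tjurina_ideal F" for a b
    unfolding J_def in_tjurina_ideal by (intro exI[of _ 0] exI[of _ a] exI[of _ b]) simp
  have LI: "\<And>l. l \<in> L \<Longrightarrow> l \<in> I" using assms(3) by blast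
  show ?thesis
  proof (intro equalityI subsetI)
    fix o' assume "o' \<in> order_set k (vanishing_part (jacobian_ideal I \<phi> F) L)"
    then obtain a b where ab: "o' = t_order (fps_to_fls (\<phi> k (J a b)))" "\<forall>l\<in>L. \<phi> l (J a b) = 0"
      using assms(3,4) LI by (auto simp: order_set_def vanishing_part_def jac)
    then show "o' \<in> (\<lambda>x. t_order (fps_to_fls (\<phi> k x))) ` {x \<in> tjurina_ideal F. \<forall>l\<in>L. \<phi> l x = 0}"
      using JT[of a b] by blast
  next
    fix o' assume "o' \<in> (\<lambda>x. t_order (fps_to_fls (\<phi> k x))) ` {x \<in> tjurina_ideal F. \<forall>l\<in>L. \<phi> l x = 0}"
    then obtain x where x: "x \<in> tjurina_ideal F" "\<forall>l\<in>L. \<phi> l x = 0" "o' = t_order (fps_to_fls (\<phi> k x))"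
      by blast
    obtain a b where ab: "\<forall>i\<in>I. \<phi> i x = \<phi> i (J a b)" using T x by blast
    let ?z = "\<lambda>i\<in>I. fps_to_fls (\<phi> i (J a b))"
    have "?z \<in> vanishing_part (jacobian_ideal I \<phi> F) L"
      using ab x LI unfolding vanishing_part_def jac by auto
    moreover have "o' = t_order (?z k)" using ab x assms(4) by simp
    ultimately show "o' \<in> order_set k (vanishing_part (jacobian_ideal I \<phi> F) L)"
      unfolding order_set_def by blast
  qed
qed

text \<open>Modulo \<open>f k\<close>, a derivative of the product is the derivative of
  \<open>f k\<close> times the other factors, which can be cancelled. It yields a partial derivative
  of \<open>F\<close> that is nonzero on the branch \<open>k\<close>.\<close>

lemma dvd_deriv_prodD:
  assumes "finite A" "k \<in> A" "prime_elem (f k)" "\<And>l. l \<in> A \<Longrightarrow> l \<noteq> k \<Longrightarrow> \<not> f k dvd f l"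
  shows "f k dvd deriv_X (prod f A) \<Longrightarrow> f k dvd deriv_X (f k)"
    and "f k dvd deriv_Y (prod f A) \<Longrightarrow> f k dvd deriv_Y (f k)"
proof -
  define g where "g = prod f (A - {k})"
  have g: "prod f A = f k * g" using assms(1,2) by (simp add: g_def prod.remove)
  have cancel: "f k dvd x" if "f k dvd g * x" for x
  proof (rule prime_elem_dvd_prod_cancel[OF assms(3)])
    show "f k dvd prod f (A - {k}) * x" using that by (simp add: g_def)
    show "\<not> f k dvd f l" if "l \<in> A - {k}" for l using assms(4) that by blast
  qed
  show "f k dvd deriv_X (f k)" if "f k dvd deriv_X (prod f A)"
  proof -
    have "f k dvd g * deriv_X (f k)"
      using that unfolding g deriv_X_mult by (simp add: dvd_add_right_iff mult.commute)
    then show ?thesis by (rule cancel)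
  qed
  show "f k dvd deriv_Y (f k)" if "f k dvd deriv_Y (prod f A)"
  proof -
    have "f k dvd g * deriv_Y (f k)"
      using that unfolding g deriv_Y_mult by (simp add: dvd_add_right_iff mult.commute)
    then show ?thesis by (rule cancel)
  qed
qed

theorem theorem3p4:
  fixes r j :: nat
    and f :: "nat \<Rightarrow> conv2"
    and \<phi> :: "nat \<Rightarrow> conv2 \<Rightarrow> complex fps"
    and F :: conv2
    and N :: "nat set \<Rightarrow> (nat \<Rightarrow> complex fls) set"
  assumes "r > 1"
    and "\<And>i. i \<in> {1..r} \<Longrightarrow> irreducible (f i)"
    and "\<And>i l. i \<in> {1..r} \<Longrightarrow> l \<in> {1..r} \<Longrightarrow> i \<noteq> l \<Longrightarrow> ideal_gen {f i} \<noteq> ideal_gen {f l}"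
    and "\<And>i. i \<in> {1..r} \<Longrightarrow> normalization (f i) (\<phi> i)"
    and "F = (\<Prod>i\<in>{1..r}. f i)"
    and "\<And>L. N L = vanishing_part (jacobian_ideal {1..r} \<phi> F) L"
    and "1 \<le> j" and "j < r"
  shows "tjurina F =
           tjurina (\<Prod>i\<in>{1..j}. f i) + tjurina (\<Prod>k\<in>{j+1..r}. f k)
           + (\<Sum>i\<in>{1..j}. \<Sum>k\<in>{j+1..r}. intersection_mult (f i) (f k))
           + (\<Sum>k\<in>{j+1..r}. ecard (order_set k (N {j+1..<k}) - order_set k (N {1..<k})))"
proof -
  note irr = assms(2) and norm = assms(4)
  define g where "g = (\<Prod>i\<in>{1..j}. f i)"
  define h where "h = (\<Prod>k\<in>{j+1..r}. f k)"
  define T where "T = tjurina_ideal F"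
  define Q where "Q = {x \<in> T. g dvd x}"
  \<comment> \<open>\<open>P k\<close> and \<open>Qk k\<close> lift \<open>N {j+1..<k}\<close> and
    \<open>N {1..<k}\<close>. The conditions stop below \<open>k\<close>: \<open>P (j+1)\<close> is
    all of \<open>T\<close>, which is the convention with \<open>\<Delta>\<close>, and
    \<open>P (r+1)\<close> consists of the multiples of \<open>h\<close> in
    \<open>T\<close>.\<close>
  define P where "P k = {x \<in> T. \<forall>l\<in>{j+1..<k}. f l dvd x}" for k
  define Qk where "Qk k = {x \<in> T. \<forall>l\<in>{1..<k}. f l dvd x}" for k
  have prime: "prime_elem (f i)" if "i \<in> {1..r}" for i
    using that norm irr normalization_prime_elem by blast
  have ndvd: "\<not> f i dvd f l" if "i \<in> {1..r}" "l \<in> {1..r}" "i \<noteq> l" for i l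
    using that irr assms(3) irreducible_dvd_ideal_gen_eq by blast
  have prod_dvd: "prod f A dvd x \<longleftrightarrow> (\<forall>i\<in>A. f i dvd x)" if A: "A \<subseteq> {1..r}" for A x
  proof
    show "\<forall>i\<in>A. f i dvd x" if "prod f A dvd x"
      using that A finite_subset[OF A] by (meson dvd_prodI dvd_trans finite_atLeastAtMost)
    show "prod f A dvd x" if "\<forall>i\<in>A. f i dvd x"
    proof (rule prod_prime_elem_dvd)
      show "finite A" using finite_subset[OF A] by simp
      show "prime_elem (f i)" if "i \<in> A" for i using prime A that by blast
      show "\<not> f i dvd f l" if "i \<in> A" "l \<in> A" "i \<noteq> l" for i l
        using ndvd[of i l] A that by blast
    qed (use that in blast)
  qed
  have cancel: "prod f A dvd x"
    if A: "A \<subseteq> {1..r}" "B \<subseteq> {1..r}" "A \<inter> B = {}" and x: "prod f A dvd prod f B * x" for A B x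
  proof -
    have "f i dvd x" if i: "i \<in> A" for i
    proof (rule prime_elem_dvd_prod_cancel)
      show "prime_elem (f i)" using prime A i by blast
      show "f i dvd prod f B * x" using x i prod_dvd[OF A(1)] by blast
      show "\<not> f i dvd f l" if "l \<in> B" for l using ndvd[of i l] that A i by blast
    qed
    then show ?thesis using prod_dvd[OF A(1)] by blast
  qed
  have split: "{1..r} = {1..j} \<union> {j+1..r}" using assms(7,8) by auto
  have Fgh: "F = g * h"
    unfolding assms(5) g_def h_def split by (rule prod.union_disjoint) auto
  have hg: "h dvd x" if "h dvd g * x" for x
    using cancel[of "{j+1..r}" "{1..j}" x] that assms(8) by (auto simp: g_def h_def)
  have gh: "g dvd x" if "g dvd h * x" for x
    using cancel[of "{1..j}" "{j+1..r}" x] that assms(8) by (auto simp: g_def h_def)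
  have T: "conv2_ideal.subspace T" by (simp add: T_def)
  have ideal: "conv2_ideal.subspace {x \<in> T. \<forall>l\<in>L. f l dvd x}" for L
    using T by (auto simp: conv2_ideal.subspace_def)
  have P: "conv2.subspace (P k)" and Qk: "conv2_ideal.subspace (Qk k)" for k
    unfolding P_def Qk_def using ideal by (auto intro: subspace_if_ideal)
  have Q_eq: "Q = {x \<in> T. \<forall>l\<in>{1..j}. f l dvd x}"
    using prod_dvd[of "{1..j}"] assms(8) by (auto simp: Q_def g_def)
  have Q: "conv2.subspace Q" unfolding Q_eq using ideal by (rule subspace_if_ideal)
  have Q0: "0 \<in> Q" and P0: "0 \<in> P k" for k using P Q conv2.subspace_0 by auto

  have inter: "intersection_mult g h = (\<Sum>i\<in>{1..j}. \<Sum>k\<in>{j+1..r}. intersection_mult (f i) (f k))"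
  proof -
    have "intersection_mult g h = (\<Sum>i\<in>{1..j}. intersection_mult (f i) h)"
      unfolding g_def
    proof (rule intersection_mult_prod_left)
      show "h dvd x" if "i \<in> {1..j}" "h dvd f i * x" for i x
        using cancel[of "{j+1..r}" "{i}" x] that assms(8) by (auto simp: h_def)
    qed simp
    also have "\<dots> = (\<Sum>i\<in>{1..j}. \<Sum>k\<in>{j+1..r}. intersection_mult (f i) (f k))"
    proof (rule sum.cong)
      fix i assume i: "i \<in> {1..j}"
      have "intersection_mult h (f i) = (\<Sum>k\<in>{j+1..r}. intersection_mult (f k) (f i))"
        unfolding h_def
      proof (rule intersection_mult_prod_left)
        show "f i dvd x" if "k \<in> {j+1..r}" "f i dvd f k * x" for k x
          using cancel[of "{i}" "{k}" x] that i assms(8) by auto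
      qed simp
      then show "intersection_mult (f i) h = (\<Sum>k\<in>{j+1..r}. intersection_mult (f i) (f k))"
        by (simp add: intersection_mult_commute)
    qed simp
    finally show ?thesis .
  qed

  have step: "conv2.reldim (P k + Q) (P (Suc k) + Q)
      = ecard (order_set k (N {j+1..<k}) - order_set k (N {1..<k}))" if k: "k \<in> {j+1..r}" for k
  proof -
    have kr: "k \<in> {1..r}" using k by auto
    have hom: "branch_hom (\<phi> i)" if "i \<in> {1..r}" for i
      using norm that normalization_branch_hom by blast
    have ker: "\<phi> i x = 0 \<longleftrightarrow> f i dvd x" if "i \<in> {1..r}" for i x
      using norm that normalization_kernel by blast
    interpret branch_hom "\<phi> k" using kr by (rule hom)
    have P_Suc: "P (Suc k) = {x \<in> P k. \<phi> k x = 0}"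
      using k kr by (auto simp: P_def ker less_Suc_eq)
    have Qk_eq: "Qk k = P k \<inter> Q"
    proof -
      have "{1..<k} = {1..j} \<union> {j+1..<k}" using k assms(7) by auto
      then show ?thesis by (auto simp: Qk_def P_def Q_eq)
    qed
    \<comment> \<open>Second isomorphism theorem with the modular law: \<open>P (Suc k)\<close> lies
      in \<open>P k\<close>, and \<open>P k\<close> meets \<open>Q\<close> in
      \<open>Qk k\<close>.\<close>
    have "conv2.reldim (P k + Q) (P (Suc k) + Q) = conv2.reldim (P k) (P (Suc k) + Qk k)"
    proof (rule conv2.reldim_map[OF linear_mult_conv2[of 1]])
      show "P (Suc k) + Qk k \<subseteq> P k"
        using P[of k] conv2.subspace_add by (auto simp: P_Suc Qk_eq elim!: set_plus_elim)
      show "1 * x \<in> P k + Q" if "x \<in> P k" for x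
        using set_plus_intro[OF that Q0] by simp
      show "1 * x \<in> P (Suc k) + Q \<longleftrightarrow> x \<in> P (Suc k) + Qk k" if "x \<in> P k" for x
        using that conv2.subspace_diff[OF P[of k]] by (auto simp: in_set_plus_iff P_Suc Qk_eq)
      show "\<exists>x\<in>P k. y - 1 * x \<in> P (Suc k) + Q" if y: "y \<in> P k + Q" for y
      proof -
        obtain p q where "p \<in> P k" "q \<in> Q" "y = p + q" using y by (rule set_plus_elim)
        then show ?thesis using set_plus_intro[OF P0 \<open>q \<in> Q\<close>] by (intro bexI[of _ p]) auto
      qed
    qed (use P Q Qk subspace_if_ideal in \<open>auto intro: set_plus_subspace\<close>)
    also have "\<dots> = ecard ((\<lambda>x. t_order (fps_to_fls (\<phi> k x))) ` P k - (\<lambda>x. t_order (fps_to_fls (\<phi> k x))) ` Qk k)"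
    proof -
      \<comment> \<open>\<open>D\<close> is a partial derivative of \<open>F\<close>. Multiplied by
        \<open>f 1, ..., f (k-1)\<close> it becomes the element of \<open>Qk k\<close> with nonzero
        image that the order count requires.\<close>
      obtain D where D: "D \<in> T" "\<not> f k dvd D"
      proof -
        have "\<not> (f k dvd deriv_X F \<and> f k dvd deriv_Y F)"
          unfolding assms(5)
          using dvd_deriv_prodD[of "{1..r}" k f] normalization_not_dvd_derivs[OF norm[OF kr]]
            prime[OF kr] ndvd kr by (metis finite_atLeastAtMost prime_elem_def)
        moreover have "deriv_X F \<in> T" "deriv_Y F \<in> T"
          using in_tjurina_ideal[of "deriv_X F" F] in_tjurina_ideal[of "deriv_Y F" F]
          unfolding T_def by (metis add.left_neutral add.right_neutral mult_1 mult_zero_left)+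
        ultimately show thesis using that by blast
      qed
      have "\<not> f k dvd prod f {1..<k} * D"
        using prime_elem_dvd_prod_cancel[OF prime[OF kr], of "{1..<k}" f D] ndvd[of k] k D(2) by auto
      moreover have "f l dvd prod f {1..<k} * D" if "l \<in> {1..<k}" for l
        using that by (intro dvd_mult2 dvd_prodI) auto
      moreover have "prod f {1..<k} * D \<in> T" using T D conv2_ideal.subspace_scale by blast
      ultimately have "prod f {1..<k} * D \<in> Qk k" "\<phi> k (prod f {1..<k} * D) \<noteq> 0"
        by (auto simp: Qk_def ker[OF kr])
      then show ?thesis
        unfolding P_Suc using Qk_eq by (intro reldim_eq_ecard_orders[OF norm[OF kr] P Qk]) auto
    qed
    also have "(\<lambda>x. t_order (fps_to_fls (\<phi> k x))) ` P k = order_set k (N {j+1..<k})"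
      unfolding assms(6) P_def T_def using k kr hom ker
      by (subst order_set_vanishing_part) (auto simp: assms(5) intro!: image_cong)
    also have "(\<lambda>x. t_order (fps_to_fls (\<phi> k x))) ` Qk k = order_set k (N {1..<k})"
      unfolding assms(6) Qk_def T_def using k kr hom ker
      by (subst order_set_vanishing_part) (auto simp: assms(5) intro!: image_cong)
    finally show ?thesis .
  qed

  \<comment> \<open>The sum over the branches of \<open>C_K\<close> telescopes from \<open>T\<close>
    down to \<open>Q\<close> plus the multiples of \<open>h\<close> in \<open>T\<close>, the last
    term of \<open>tjurina_mult\<close>.\<close>
  have "conv2.reldim (P (j+1) + Q) (P (r+1) + Q) = (\<Sum>k=j+1..<r+1. conv2.reldim (P k + Q) (P (Suc k) + Q))"
  proof (rule conv2.reldim_chain)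
    show "P (Suc n) + Q \<subseteq> P n + Q" for n by (rule set_plus_mono2) (auto simp: P_def)
  qed (use P Q assms(8) in \<open>auto intro: set_plus_subspace\<close>)
  also have "\<dots> = (\<Sum>k\<in>{j+1..r}. ecard (order_set k (N {j+1..<k}) - order_set k (N {1..<k})))"
    using step by (intro sum.cong) auto
  also have "P (j+1) + Q = T"
  proof
    show "P (j+1) + Q \<subseteq> T"
      using conv2.subspace_add[OF subspace_if_ideal[OF T]] by (auto simp: P_def Q_def elim!: set_plus_elim)
    show "T \<subseteq> P (j+1) + Q" using set_plus_intro[OF _ Q0, of _ "P (j+1)"] by (auto simp: P_def)
  qed
  also have "P (r+1) = {x \<in> T. h dvd x}"
    using prod_dvd[of "{j+1..r}"] assms(7,8) by (auto simp: P_def h_def)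
  finally have "conv2.reldim T (Q + {x \<in> T. h dvd x})
      = (\<Sum>k\<in>{j+1..r}. ecard (order_set k (N {j+1..<k}) - order_set k (N {1..<k})))"
    by (simp only: add.commute)
  then show ?thesis
    using tjurina_mult[OF hg gh] inter unfolding Fgh[symmetric] T_def[symmetric] Q_def[symmetric]
    by (simp only: g_def h_def)
qed

end
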